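(* Let $q\in(0,1)$ and let $(R_n(x;q))_{n\in\mathbb{N}_0}$ be the little $q$-Legendre polynomials, with Haar weights $h(n)=\frac{1}{q^n}\frac{1-q^{2n+1}}{1-q}$. For $x\in\mathbb{R}$ let $\alpha_x:\mathbb{N}_0\to\mathbb{R}$, $\alpha_x(k)=R_k(x;q)$, and for $p\in\{1,2\}$ let $\|f\|_p=\left(\sum_{k=0}^\infty|f(k)|^p h(k)\right)^{1/p}$. Then there is some $C>0$ such that \[0<\|\alpha_{1-q^n}\|_2^2<\|\alpha_{1-q^n}\|_1<C\|\alpha_{1-q^n}\|_2^2\] for all $n\in\mathbb{N}_0$. It is possible to take \[C=\frac{1}{q^{K}}\left[\frac{1}{1-q}+\frac{1}{1-q^{2K+1}}\sum_{k=1}^\infty4^k q^{\frac{(2K+k-1)k}{2}}\right],\qquad K=\left\lceil\frac{\log4}{\log\frac{1}{q}}-1\right\rceil.\]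
   Context: For $q\in(0,1)$, the little $q$-Legendre polynomials are defined by $R_0(x;q)=1$, $R_1(x;q)=(x-b_0)/a_0$ and $R_1(x;q)R_n(x;q)=a_nR_{n+1}(x;q)+b_nR_n(x;q)+c_nR_{n-1}(x;q)$ for $n\ge1$, where $a_0=\frac{1}{q+1}$, $b_0=\frac{q}{q+1}$, and for $n\ge1$: $a_n=q^n\frac{(1+q)(1-q^{n+1})}{(1-q^{2n+1})(1+q^{n+1})}$, $c_n=q^n\frac{(1+q)(1-q^n)}{(1-q^{2n+1})(1+q^n)}$, $b_n=1-a_n-c_n=\frac{(1-q^n)(1-q^{n+1})}{(1+q^n)(1+q^{n+1})}$. Equivalently $R_n(x;q)=\sum_{k=0}^n\frac{(q^{-n};q)_k(q^{n+1};q)_k}{(q;q)_k^2}(q-qx)^k$. They satisfy $R_n(1;q)=1$ and are orthogonal with respect to the probability measure $\mu$ with $\mu(\{1-q^n\})=q^n(1-q)$ ($n\in\mathbb{N}_0$). The functions $\alpha_{1-q^n}$ belong to $\ell^1(h)$. *)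

theory Defs
  imports Complex_Main
begin

definition qpoch :: "real \<Rightarrow> real \<Rightarrow> nat \<Rightarrow> real" where
  "qpoch a q k = (\<Prod>j<k. 1 - a * q ^ j)"

definition littleqLeg :: "real \<Rightarrow> nat \<Rightarrow> real \<Rightarrow> real" where
  "littleqLeg q n x = (\<Sum>k=0..n. qpoch (inverse (q ^ n)) q k * qpoch (q ^ (n+1)) q k
        / (qpoch q q k)^2 * (q - q * x) ^ k)"

definition haar :: "real \<Rightarrow> nat \<Rightarrow> real" where
  "haar q n = (1 / q ^ n) * (1 - q ^ (2*n+1)) / (1 - q)"

definition alpha :: "real \<Rightarrow> real \<Rightarrow> nat \<Rightarrow> real" where
  "alpha q x k = littleqLeg q k x"

definition norm1 :: "real \<Rightarrow> (nat \<Rightarrow> real) \<Rightarrow> real" where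
  "norm1 q f = (\<Sum>k. \<bar>f k\<bar> * haar q k)"

definition norm2sq :: "real \<Rightarrow> (nat \<Rightarrow> real) \<Rightarrow> real" where
  "norm2sq q f = (\<Sum>k. \<bar>f k\<bar>^2 * haar q k)"

definition Kq :: "real \<Rightarrow> nat" where
  "Kq q = nat \<lceil>ln 4 / ln (1 / q) - 1\<rceil>"

definition Cq :: "real \<Rightarrow> real" where
  "Cq q = (1 / q ^ Kq q) * (1 / (1 - q) + 1 / (1 - q ^ (2 * Kq q + 1)) *
     (\<Sum>k. 4 ^ (k+1) * q powr ((2 * real (Kq q) + real (k+1) - 1) * real (k+1) / 2)))"

end

theory Submission
  imports Defs
begin

text \<open>
  Write \<open>p k x = R_k(1 - x)\<close> and \<open>y m k = p k (q ^ m)\<close>. These functions satisfy a three-term recurrence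
  in \<open>k\<close> and a second-order \<open>q\<close>-difference equation in \<open>m\<close>. The latter, started from
  \<open>y 0 k = \<plusminus> q ^ (k (k + 1) / 2)\<close>, shows that every \<open>y m\<close> decays faster than exponentially in \<open>k\<close>, so
  all series converge. Summing the recurrence by parts gives \<open>\<langle>y a, y b\<rangle> = 0\<close> for \<open>a \<noteq> b\<close>, and testing
  the (self-adjoint) difference equation on neighbours gives \<open>q \<parallel>y (m + 1)\<parallel>\<^sup>2 = \<parallel>y m\<parallel>\<^sup>2\<close>; hence
  \<open>\<parallel>y m\<parallel>\<^sup>2 = q ^ (-m) / (1 - q)\<close>.

  The bound \<open>\<bar>y m k\<bar> \<le> 1\<close>, from which the lower inequality follows, comes from a Lyapunov function:
  adding suitable nonnegative multiples of the squares of all iterated \<open>q\<close>-derivatives of \<open>p k\<close> to its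
  square yields a quantity that is nondecreasing along \<open>q ^ m\<close> and tends to \<open>p k 0 = 1\<close>.

  For the upper inequality, \<open>\<bar>y m k\<bar> \<le> 1\<close> is used up to \<open>k = m + K\<close>. Beyond that index \<open>y m\<close> is the
  minimal solution of a recurrence in its hyperbolic regime, which forces
  \<open>\<bar>y m k\<bar> \<le> 4 q ^ (k - m) \<bar>y m (k - 1)\<bar>\<close> and produces the series in the constant.
\<close>

section \<open>Polynomials in the reflected variable, their q-derivatives and energies\<close>

definition legp :: "real \<Rightarrow> nat \<Rightarrow> real \<Rightarrow> real" where
  "legp q n x = littleqLeg q n (1 - x)"

definition lcoef :: "real \<Rightarrow> nat \<Rightarrow> nat \<Rightarrow> real" where
  "lcoef q n j = qpoch (inverse (q ^ n)) q j * qpoch (q ^ (n+1)) q j / (qpoch q q j)^2"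

definition legp_eigenvalue :: "real \<Rightarrow> nat \<Rightarrow> real" where
  "legp_eigenvalue q n = (1 - q ^ n) * (1 - q ^ (n+1)) / q ^ n"

text \<open>With \<open>D_n = recur_coef q n * (p n - p (n - 1))\<close>, the recurrence reads
  \<open>D_(n + 1) = D_n - x * haar_wt q n * p n\<close>.\<close>

definition recur_coef :: "real \<Rightarrow> nat \<Rightarrow> real" where
  "recur_coef q n = (1 - q ^ n) / (1 + q ^ n)"

text \<open>This is \<open>haar\<close> multiplied by \<open>1 - q\<close>; the constant factor
  returns when the norms are assembled.\<close>

definition haar_wt :: "real \<Rightarrow> nat \<Rightarrow> real" where
  "haar_wt q n = (1 - q ^ (2*n+1)) / q ^ n"

text \<open>Each order carries a factor \<open>q - 1\<close> compared with the usual q-derivative.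
  At \<open>x = 0\<close> division yields 0 for positive orders, so statements about it exclude 0 or
  stay on the grid.\<close>

primrec qder :: "real \<Rightarrow> (real \<Rightarrow> real) \<Rightarrow> nat \<Rightarrow> real \<Rightarrow> real" where
  "qder q f 0 = f"
| "qder q f (Suc i) = (\<lambda>x. (qder q f i (q * x) - qder q f i x) / x)"

text \<open>The value at \<open>Suc i\<close> belongs to the equation for the \<open>i\<close>-th
  q-derivative. For \<open>i \<le> n + 1\<close> it factors as
  \<open>(1 - q^(n-i+1)) * (1 - q^(n+i)) / q^n\<close>: positive for
  \<open>1 \<le> i \<le> n\<close>, zero at \<open>i = n + 1\<close>.\<close>

definition qder_eigenvalue :: "real \<Rightarrow> nat \<Rightarrow> nat \<Rightarrow> real" where
  "qder_eigenvalue q n i = 1 / q ^ n - q / q ^ i - q ^ i + q ^ (n+1)"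

text \<open>The weight of the little \<open>q\<close>-Jacobi polynomials with \<open>a = b = q ^ i\<close>; the \<open>i\<close>-th \<open>q\<close>-derivative
  of \<open>legp q n\<close> is a multiple of such a polynomial.\<close>

definition jacobi_weight :: "real \<Rightarrow> nat \<Rightarrow> real \<Rightarrow> real" where
  "jacobi_weight q i x = x ^ i * qpoch (q * x) q i"

text \<open>Chosen so that the fluxes in the lemma \<open>energy_step\<close> cancel between consecutive orders.\<close>

primrec energy_coef :: "real \<Rightarrow> nat \<Rightarrow> nat \<Rightarrow> real" where
  "energy_coef q n 0 = 1"
| "energy_coef q n (Suc i) = energy_coef q n i / (q * qder_eigenvalue q n (Suc i))"

definition energy :: "real \<Rightarrow> nat \<Rightarrow> nat \<Rightarrow> real \<Rightarrow> real" where
  "energy q n i x = energy_coef q n i * jacobi_weight q i x * (qder q (legp q n) i x)^2"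

definition flux :: "real \<Rightarrow> nat \<Rightarrow> nat \<Rightarrow> real \<Rightarrow> real" where
  "flux q n i x = energy_coef q n i * jacobi_weight q i (x / q) * (x / q)
     * qder q (legp q n) i (x / q) * qder q (legp q n) (Suc i) (x / q)"

text \<open>The shifts align the fluxes from \<open>energy_step\<close>: order \<open>k\<close>
  always occurs at \<open>x / q ^ k\<close>. The weights \<open>q ^ Suc k\<close> absorb the factor
  \<open>1 / q\<close> there, so the sum over all orders telescopes.\<close>

definition total_energy :: "real \<Rightarrow> nat \<Rightarrow> real \<Rightarrow> real" where
  "total_energy q n x = (legp q n x)^2 + 2 * (\<Sum>k<n. q ^ Suc k * energy q n (Suc k) (x / q ^ Suc k))"

text \<open>Strong enough to survive multiplication by the eigenvalues and Haar weights, which are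
  at most \<open>1 / q ^ k\<close>.\<close>

definition rapid :: "real \<Rightarrow> (nat \<Rightarrow> real) \<Rightarrow> bool" where
  "rapid q f \<longleftrightarrow> (\<forall>N. \<exists>C. \<forall>k. \<bar>f k\<bar> \<le> C * q ^ (N * k))"

definition Cq_term :: "real \<Rightarrow> nat \<Rightarrow> real" where
  "Cq_term q k = 4 ^ (k+1) * q powr ((2 * real (Kq q) + real (k+1) - 1) * real (k+1) / 2)"

section \<open>Recurrence and q-difference equation\<close>

lemma qpoch_0 [simp]: "qpoch a q 0 = 1"
  by (simp add: qpoch_def)

lemma qpoch_Suc: "qpoch a q (Suc k) = qpoch a q k * (1 - a * q ^ k)"
  by (simp add: qpoch_def)

lemma qpoch_Suc_shift: "qpoch a q (Suc k) = (1 - a) * qpoch (a * q) q k"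
  unfolding qpoch_def by (subst prod.lessThan_Suc_shift) (simp add: mult.assoc)

context
  fixes q :: real
  assumes q0: "0 < q" and q1: "q < 1"
begin

lemma pow_less_1: "q ^ Suc k < 1"
  using q0 q1 power_Suc_less_one by blast

lemma qpoch_q_nz: "qpoch q q k \<noteq> 0"
  proof -
  have "1 - q * q ^ j \<noteq> 0" for j using pow_less_1[of j] by simp
  then show ?thesis unfolding qpoch_def by simp
qed

lemma lcoef_0 [simp]: "lcoef q n 0 = 1"
  by (simp add: lcoef_def)

lemma lcoef_eq_0: assumes "n < j" shows "lcoef q n j = 0"
proof -
  have "qpoch (inverse (q ^ n)) q j = 0"
    unfolding qpoch_def using assms q0 by (auto simp: prod_zero_iff intro!: bexI[of _ n])
  then show ?thesis by (simp add: lcoef_def)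
qed

text \<open>The free upper limit \<open>N\<close> puts polynomials of neighbouring degrees on one
  summation range.\<close>

lemma legp_eq_sum:
  assumes "n \<le> N"
  shows "legp q n x = (\<Sum>j\<le>N. lcoef q n j * (q * x) ^ j)"
proof -
  have "legp q n x = (\<Sum>j\<le>n. lcoef q n j * (q * x) ^ j)"
    by (simp add: legp_def littleqLeg_def lcoef_def atLeast0AtMost algebra_simps)
  also have "\<dots> = (\<Sum>j\<le>N. lcoef q n j * (q * x) ^ j)"
    by (rule sum.mono_neutral_left) (use assms lcoef_eq_0 in auto)
  finally show ?thesis .
qed

lemma legp_at_0: "legp q n 0 = 1"
  by (subst legp_eq_sum[of n n]) (auto simp: power_0_left if_distrib sum.delta cong: if_cong)

lemma legp_0 [simp]: "legp q 0 x = 1"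
  by (subst legp_eq_sum[of 0 0]) auto

lemma lcoef_Suc:
  "lcoef q n (Suc j) * (1 - q ^ Suc j)^2 = lcoef q n j * ((1 - q ^ j / q ^ n) * (1 - q ^ (n+1+j)))"
proof -
  have "1 - q * q ^ j \<noteq> 0" using pow_less_1[of j] by simp
  note nz = this qpoch_q_nz[of j]
  have "A * (1 - a) * (B * (1 - b)) / (R * d)^2 * d^2 = A * B / R^2 * ((1 - a) * (1 - b))"
    if "d \<noteq> 0" "R \<noteq> 0" for A B R a b d :: real
    using that by (simp add: power_mult_distrib)
  from this[OF nz, of "qpoch (inverse (q ^ n)) q j" "inverse (q ^ n) * q ^ j" "qpoch (q ^ (n+1)) q j" "q ^ (n+1) * q ^ j"]
  show ?thesis
    unfolding lcoef_def qpoch_Suc by (simp only: power_add power_Suc power_one_right power_0 mult_1_right mult_ac divide_inverse)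
qed

text \<open>Coefficient \<open>j\<close> contributes in degrees \<open>j\<close> and
  \<open>j + 1\<close>; by \<open>lcoef_Suc\<close>, its part in degree \<open>j + 1\<close> cancels
  the contribution of coefficient \<open>j + 1\<close> there.\<close>

lemma legp_qdiff:
  assumes "x \<noteq> 0"
  shows "(1 - q * x) * (legp q n (q * x) - legp q n x)
       = (1 - x) * (legp q n x - legp q n (x / q)) - legp_eigenvalue q n * x * legp q n x"
proof -
  \<comment> \<open>Boundary terms: the coefficientwise identity telescopes.\<close>
  define U where "U j = lcoef q n j * x ^ j * (1 - q ^ j)^2" for j
  define c where "c j = lcoef q n j * q ^ j" for j
  have p: "legp q n z = (\<Sum>j\<le>n. c j * z ^ j)" for z
    by (subst legp_eq_sum[of n n]) (simp_all add: c_def power_mult_distrib mult.assoc)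
  have tele: "(1 - q * x) * (c j * (q * x) ^ j - c j * x ^ j)
      - (1 - x) * (c j * x ^ j - c j * (x / q) ^ j) + legp_eigenvalue q n * x * (c j * x ^ j) = U j - U (Suc j)" for j
  proof -
    have U: "U (Suc j) = x * x ^ j * (lcoef q n j * ((1 - q ^ j / q ^ n) * (1 - q ^ (n+1+j))))"
      unfolding U_def lcoef_Suc[symmetric] by (simp add: algebra_simps)
    have "(1 - q * x) * (l * Q * (Q * X) - l * Q * X) - (1 - x) * (l * Q * X - l * Q * (X / Q))
        + (1 - N) * (1 - N * q) / N * x * (l * Q * X)
      = l * X * (1 - Q)^2 - x * X * (l * ((1 - Q / N) * (1 - N * q * Q)))" if "N > 0" "Q > 0" for l Q X N :: real
      using that by (simp add: field_simps power2_eq_square)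
    from this[of "q ^ n" "q ^ j" "lcoef q n j" "x ^ j"] show ?thesis
      unfolding U unfolding U_def c_def legp_eigenvalue_def using q0
      by (simp add: power_mult_distrib power_divide power_add mult.commute)
  qed
  have "(1 - q * x) * (legp q n (q * x) - legp q n x)
      - (1 - x) * (legp q n x - legp q n (x / q)) + legp_eigenvalue q n * x * legp q n x = (\<Sum>j\<le>n. U j - U (Suc j))"
    unfolding tele[symmetric] p by (simp add: sum_subtractf sum.distrib flip: sum_distrib_left)
  also have "\<dots> = U 0 - U (Suc n)" by (rule sum_telescope)
  also have "\<dots> = 0" by (simp add: U_def lcoef_eq_0)
  finally show ?thesis by simp
qed

text \<open>Passing from \<open>n - 1\<close> to \<open>n\<close> shifts the two Pochhammer bases in
  opposite directions, so the products share all but their end factors. The end factors differ by a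
  multiple of \<open>1 + q ^ n\<close>, the denominator of \<open>recur_coef\<close>.\<close>

lemma lcoef_diff:
  "recur_coef q n * (lcoef q n (Suc i) - lcoef q (n-1) (Suc i))
   = - (1 - q ^ Suc i) * (1 - q ^ n)^2 / q ^ n * qpoch (q / q ^ n) q i * qpoch (q ^ (n+1)) q i / (qpoch q q (Suc i))^2"
proof (cases n)
  case 0 then show ?thesis by (simp add: recur_coef_def)
next
  case (Suc k)
  have 1: "qpoch (inverse (q ^ n)) q (Suc i) = (1 - inverse (q ^ n)) * qpoch (q / q ^ n) q i"
    using qpoch_Suc_shift[of "inverse (q ^ n)" q i] by (simp add: field_simps)
  have 2: "qpoch (inverse (q ^ k)) q (Suc i) = qpoch (q / q ^ n) q i * (1 - q / q ^ n * q ^ i)"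
    using q0 by (simp add: Suc qpoch_Suc field_simps)
  have 3: "qpoch (q ^ (k+1)) q (Suc i) = (1 - q ^ n) * qpoch (q ^ (n+1)) q i"
    unfolding qpoch_Suc_shift by (simp add: Suc mult.commute)
  have pos: "1 + q ^ n > 0" "q ^ n > 0" using q0 by (auto intro: add_pos_pos)
  have "recur_coef q n * ((1 - inverse (q ^ n)) * (1 - q ^ (n+1) * q ^ i) - (1 - q / q ^ n * q ^ i) * (1 - q ^ n))
    = - (1 - q ^ Suc i) * (1 - q ^ n)^2 / q ^ n"
  proof -
    have "(1 - inverse Q) * (1 - Q * q * I) - (1 - q / Q * I) * (1 - Q) = - (1 - q * I) * (1 - Q) * (1 + Q) / Q"
      if "Q > 0" for Q I :: real
      using that by (simp add: field_simps)
    from this[OF pos(2), of "q ^ i"] show ?thesis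
      unfolding recur_coef_def using pos by (simp add: power2_eq_square mult.commute mult.left_commute)
  qed
  note key = this
  have "recur_coef q n * (lcoef q n (Suc i) - lcoef q (n-1) (Suc i))
     = (recur_coef q n * ((1 - inverse (q ^ n)) * (1 - q ^ (n+1) * q ^ i) - (1 - q / q ^ n * q ^ i) * (1 - q ^ n)))
       * (qpoch (q / q ^ n) q i * qpoch (q ^ (n+1)) q i / (qpoch q q (Suc i))^2)"
    unfolding lcoef_def 1 using 2 3 Suc qpoch_Suc[of "q ^ (n+1)" q i]
    by (simp add: diff_divide_distrib[symmetric] right_diff_distrib left_diff_distrib)
       (simp add: algebra_simps diff_divide_distrib)
  then show ?thesis unfolding key by simp
qed

text \<open>Coefficients of \<open>(q * x) ^ Suc i\<close> are compared: by
  \<open>lcoef_diff\<close>, both differences are multiples of the product defining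
  \<open>lcoef q n i\<close>. For \<open>n = 0\<close> the truncated index \<open>n - 1\<close> is
  harmless because \<open>recur_coef q 0 = 0\<close>.\<close>

lemma legp_recurrence:
  "recur_coef q (Suc n) * (legp q (Suc n) x - legp q n x)
   = recur_coef q n * (legp q n x - legp q (n-1) x) - x * haar_wt q n * legp q n x"
proof -
  have coef: "recur_coef q (Suc n) * (lcoef q (Suc n) (Suc i) - lcoef q n (Suc i))
      - recur_coef q n * (lcoef q n (Suc i) - lcoef q (n-1) (Suc i)) = - haar_wt q n / q * lcoef q n i" for i
  proof -
    define A where "A = qpoch (inverse (q ^ n)) q i"
    define B where "B = qpoch (q ^ (n+1)) q i"
    have A': "(1 - inverse (q ^ n)) * qpoch (q / q ^ n) q i = A * (1 - inverse (q ^ n) * q ^ i)"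
      using qpoch_Suc_shift[of "inverse (q ^ n)" q i] unfolding qpoch_Suc A_def by (simp add: field_simps)
    have B': "(1 - q ^ (n+1)) * qpoch (q ^ (Suc n+1)) q i = B * (1 - q ^ (n+1) * q ^ i)"
      using qpoch_Suc_shift[of "q ^ (n+1)" q i] unfolding qpoch_Suc B_def by (simp add: mult.commute)
    have A2: "qpoch (q / q ^ Suc n) q i = A" using q0 by (simp add: A_def field_simps)
    have qi: "1 - q ^ Suc i \<noteq> 0" using pow_less_1[of i] by simp
    have Qn: "q ^ n > 0" using q0 by simp
    have t1: "recur_coef q (Suc n) * (lcoef q (Suc n) (Suc i) - lcoef q n (Suc i))
      = - (1 - q ^ Suc i) * (1 - q ^ Suc n) / q ^ Suc n * A * (B * (1 - q ^ (n+1) * q ^ i)) / (qpoch q q (Suc i))^2"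
      using lcoef_diff[of "Suc n" i] unfolding A2 B'[symmetric] by (simp add: power2_eq_square mult.assoc)
    \<comment> \<open>One factor is rewritten as the missing front factor of the Pochhammer symbol
      in \<open>A'\<close>.\<close>
    have e: "(1 - q ^ n)^2 / q ^ n = - (1 - q ^ n) * (1 - inverse (q ^ n))"
      using Qn by (simp add: field_simps power2_eq_square del: power_eq_0_iff)
    have "recur_coef q n * (lcoef q n (Suc i) - lcoef q (n-1) (Suc i))
      = - (1 - q ^ Suc i) * ((1 - q ^ n)^2 / q ^ n) * qpoch (q / q ^ n) q i * B / (qpoch q q (Suc i))^2"
      using lcoef_diff[of n i] by (simp add: B_def)
    also have "\<dots> = (1 - q ^ Suc i) * (1 - q ^ n) * ((1 - inverse (q ^ n)) * qpoch (q / q ^ n) q i) * B / (qpoch q q (Suc i))^2"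
      unfolding e by (simp only: mult_minus_left mult_minus_right minus_minus mult.assoc)
    finally have t2: "recur_coef q n * (lcoef q n (Suc i) - lcoef q (n-1) (Suc i))
      = (1 - q ^ Suc i) * (1 - q ^ n) * (A * (1 - inverse (q ^ n) * q ^ i)) * B / (qpoch q q (Suc i))^2"
      unfolding A' .
    have "- (1 - q * I) * (1 - q * Q) / (q * Q) * A * (B * (1 - q * Q * I)) / (R * (1 - q * I))^2
        - (1 - q * I) * (1 - Q) * (A * (1 - inverse Q * I)) * B / (R * (1 - q * I))^2
        = - ((1 - q * Q * Q) / Q) / q * (A * B / R^2)" if "Q > 0" "R \<noteq> 0" "1 - q * I \<noteq> 0" for Q R I
    proof -
      have "(1 - q * Q) * (1 - q * Q * I) / (q * Q) + (1 - Q) * (1 - inverse Q * I) = (1 - q * I) * ((1 - q * Q * Q) / Q / q)"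
        using that q0 by (simp add: field_simps)
      moreover have "- (1 - q * I) * (1 - q * Q) / (q * Q) * A * (B * (1 - q * Q * I)) / (R * (1 - q * I))^2
        - (1 - q * I) * (1 - Q) * (A * (1 - inverse Q * I)) * B / (R * (1 - q * I))^2
        = - ((1 - q * Q) * (1 - q * Q * I) / (q * Q) + (1 - Q) * (1 - inverse Q * I)) * (1 - q * I) * A * B / (R * (1 - q * I))^2"
        unfolding diff_divide_distrib[symmetric] using that(1) q0
        by (intro arg_cong2[where f = "(/)"] refl) (simp add: field_simps)
      ultimately show ?thesis using that by (simp add: power_mult_distrib) (simp add: power2_eq_square)
    qed
    from this[OF Qn qpoch_q_nz[of i], of "q ^ i"] qi show ?thesis
      unfolding t1 t2 unfolding haar_wt_def lcoef_def A_def B_def qpoch_Suc[of q] 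
      by (simp add: power_add mult_2 mult.assoc)
  qed
  have p: "legp q m x = (\<Sum>j\<le>Suc n. lcoef q m j * (q * x) ^ j)" if "m \<le> Suc n" for m
    by (rule legp_eq_sum) fact
  have "recur_coef q (Suc n) * (legp q (Suc n) x - legp q n x) - recur_coef q n * (legp q n x - legp q (n-1) x)
     = (\<Sum>j\<le>Suc n. (recur_coef q (Suc n) * (lcoef q (Suc n) j - lcoef q n j)
      - recur_coef q n * (lcoef q n j - lcoef q (n-1) j)) * (q * x) ^ j)"
    by (subst (1 2 3 4) p) (simp_all only: sum_subtractf[symmetric] sum_distrib_left, simp_all add: algebra_simps)
  \<comment> \<open>The constant terms cancel, since \<open>lcoef q m 0 = 1\<close> for every
    \<open>m\<close>.\<close>
  also have "\<dots> = (\<Sum>i\<le>n. (- haar_wt q n / q * lcoef q n i) * (q * x) ^ Suc i)"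
    by (subst sum.atMost_Suc_shift) (simp only: coef, simp)
  also have "\<dots> = - x * haar_wt q n * (\<Sum>i\<le>n. lcoef q n i * (q * x) ^ i)"
    unfolding sum_distrib_left using q0 by (intro sum.cong) auto
  also have "\<dots> = - x * haar_wt q n * legp q n x" by (subst legp_eq_sum[of n n]) auto
  finally show ?thesis by simp
qed

section \<open>The bound by 1 on the grid\<close>

lemma qder_Suc_mult: "x \<noteq> 0 \<Longrightarrow> x * qder q f (Suc i) x = qder q f i (q * x) - qder q f i x"
  by simp

lemma qder_eigenvalue_1: "qder_eigenvalue q n 1 = legp_eigenvalue q n"
  using q0 by (simp add: qder_eigenvalue_def legp_eigenvalue_def field_simps)

lemma qder_eigenvalue_top: "qder_eigenvalue q n (Suc n) = 0"
  using q0 by (simp add: qder_eigenvalue_def)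

lemma qder_eigenvalue_pos: assumes "1 \<le> i" "i \<le> n" shows "qder_eigenvalue q n i > 0"
proof -
  obtain k where n: "n = i + k" using assms(2) le_Suc_ex by blast
  obtain j where i: "i = Suc j" using assms(1) by (cases i) auto
  have "qder_eigenvalue q n i = (1 - q ^ Suc k) * (1 - q ^ Suc (j + n)) / q ^ n"
    unfolding qder_eigenvalue_def n i using q0 by (simp add: field_simps power_add)
  then show ?thesis using pow_less_1[of k] pow_less_1[of "j + n"] q0 by simp
qed

text \<open>The q-analogue of differentiating a hypergeometric equation: subtracting the equation of
  order \<open>i\<close> at \<open>x\<close> from that at \<open>q * x\<close> gives one of the same
  shape for order \<open>i + 1\<close>, with a shifted eigenvalue.\<close>

lemma legp_qder_equation:
  assumes "x \<noteq> 0"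
  shows "(1 - q ^ Suc i * x) * qder q (legp q n) (Suc i) x
     - (1 - x) * qder q (legp q n) (Suc i) (x / q) / q ^ Suc i = - qder_eigenvalue q n (Suc i) * qder q (legp q n) i x"
  using assms
proof (induction i arbitrary: x)
  case 0
  have "x / q \<noteq> 0" using 0 q0 by simp
  define a b c where "a = legp q n (q * x)" and "b = legp q n x" and "c = legp q n (x / q)"
  have "(1 - q * x) * ((a - b) / x) - (1 - x) * ((b - c) / (x / q)) / q = - legp_eigenvalue q n * b"
    if "(1 - q * x) * (a - b) = (1 - x) * (b - c) - legp_eigenvalue q n * x * b"
  proof -
    have "(1 - q * x) * ((a - b) / x) - (1 - x) * ((b - c) / (x / q)) / q
      = ((1 - q * x) * (a - b) - (1 - x) * (b - c)) / x"
      using q0 by (simp add: diff_divide_distrib right_diff_distrib)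
    then show ?thesis unfolding that using 0 by simp
  qed
  then show ?case using legp_qdiff[OF 0, of n] 0 q0 qder_eigenvalue_1[of n]
    by (simp add: a_def b_def c_def)
next
  case (Suc i)
  let ?g = "qder q (legp q n)"
  define T where "T = q ^ Suc i"
  have T: "T > 0" using q0 by (simp add: T_def)
  have nz: "q * x \<noteq> 0" "x / q \<noteq> 0" using Suc.prems q0 by auto
  have h1: "(1 - q * T * x) * ?g (Suc i) (q * x) - (1 - q * x) * ?g (Suc i) x / T = - qder_eigenvalue q n (Suc i) * ?g i (q * x)"
    using Suc.IH[OF nz(1)] q0 by (simp add: T_def mult_ac)
  have h2: "(1 - T * x) * ?g (Suc i) x - (1 - x) * ?g (Suc i) (x / q) / T = - qder_eigenvalue q n (Suc i) * ?g i x"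
    using Suc.IH[OF Suc.prems] by (simp add: T_def)
  have h3: "x * ?g (Suc i) x = ?g i (q * x) - ?g i x"
    using Suc.prems by (rule qder_Suc_mult)
  have h4: "x * ?g (Suc (Suc i)) x = ?g (Suc i) (q * x) - ?g (Suc i) x"
    using Suc.prems by (rule qder_Suc_mult)
  have h5: "x * ?g (Suc (Suc i)) (x / q) = q * (?g (Suc i) x - ?g (Suc i) (x / q))"
    using qder_Suc_mult[OF nz(2), of "legp q n" "Suc i"] q0 by (simp add: field_simps del: qder.simps)
  have L: "qder_eigenvalue q n (Suc (Suc i)) = qder_eigenvalue q n (Suc i) - (1 - q) * (1 / T - T)"
    unfolding qder_eigenvalue_def T_def using q0 by (simp add: field_simps)
  define a b c d e where "a = ?g (Suc i) (q * x)" and "b = ?g (Suc i) x" and "c = ?g (Suc i) (x / q)"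
    and "d = ?g (Suc (Suc i)) x" and "e = ?g (Suc (Suc i)) (x / q)"
  note abcde = a_def[symmetric] b_def[symmetric] c_def[symmetric] d_def[symmetric] e_def[symmetric]
  have "- qder_eigenvalue q n (Suc i) * (x * b) = - qder_eigenvalue q n (Suc i) * ?g i (q * x) - (- qder_eigenvalue q n (Suc i) * ?g i x)"
    unfolding b_def h3 by (simp only: right_diff_distrib)
  also have "\<dots> = (1 - q * T * x) * a - (1 - q * x) * b / T - ((1 - T * x) * b - (1 - x) * c / T)"
    using h1 h2 unfolding abcde by simp
  finally have h6: "- qder_eigenvalue q n (Suc i) * (x * b) = \<dots>" .
  have "x * ((1 - q * T * x) * d - (1 - x) * e / (q * T)) = (1 - q * T * x) * (x * d) - (1 - x) * (x * e) / (q * T)"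
    by (simp add: algebra_simps)
  also have "\<dots> = (1 - q * T * x) * (a - b) - (1 - x) * (b - c) / T"
    using h4 h5 q0 unfolding abcde by simp
  also have "\<dots> = x * (- qder_eigenvalue q n (Suc (Suc i)) * b)"
    using h6 T unfolding L by (simp add: field_simps)
  finally have "(1 - q * T * x) * d - (1 - x) * e / (q * T) = - qder_eigenvalue q n (Suc (Suc i)) * b"
    using Suc.prems by (metis mult_left_cancel)
  then show ?case unfolding abcde T_def by (simp add: mult_ac del: qder.simps)
qed

text \<open>Since the eigenvalue at \<open>Suc n\<close> is zero, the equation becomes a first-order
  recursion along the grid; it starts with 0 because the factor \<open>1 - x\<close> vanishes at
  \<open>x = 1\<close>.\<close>

lemma legp_qder_top: "qder q (legp q n) (Suc n) (q ^ m) = 0"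
proof (induction m)
  case 0
  have "1 - q ^ Suc n \<noteq> 0" using pow_less_1[of n] by simp
  then show ?case
    using legp_qder_equation[of 1 n n] unfolding qder_eigenvalue_top by (simp del: qder.simps)
next
  case (Suc m)
  have nz: "1 - q ^ Suc n * q ^ Suc m \<noteq> 0"
    using pow_less_1[of "n + Suc m"] unfolding power_add[symmetric] by simp
  have div: "q ^ Suc m / q = q ^ m" and nz': "q ^ Suc m \<noteq> 0" using q0 by simp_all
  have "(1 - q ^ Suc n * q ^ Suc m) * qder q (legp q n) (Suc n) (q ^ Suc m) = 0"
    using legp_qder_equation[OF nz', of n n] unfolding qder_eigenvalue_top div Suc.IH by simp
  then show ?case using nz by (simp only: mult_eq_0_iff simp_thms)
qed

section \<open>Weights, energies and fluxes\<close>

lemma jacobi_weight_Suc: "jacobi_weight q (Suc i) x = jacobi_weight q i x * (x * (1 - q ^ Suc i * x))"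
  by (simp add: jacobi_weight_def qpoch_Suc mult_ac)

text \<open>With \<open>jacobi_weight_Suc\<close> this is a q-Pearson equation: the weight of order
  \<open>Suc i\<close> at \<open>x\<close> and \<open>x / q\<close> produces the two coefficients in
  \<open>legp_qder_equation\<close>.\<close>

lemma jacobi_weight_Suc_div: "jacobi_weight q (Suc i) (x / q) = jacobi_weight q i x * (x * (1 - x) / q ^ Suc i)"
  using q0 by (simp add: jacobi_weight_def qpoch_Suc_shift power_divide mult_ac)

text \<open>Such a point lies to the right of 1 and is the zero of the factor with index
  \<open>i - m - 1\<close>. The shifted arguments in \<open>total_energy\<close> that leave the grid
  thus contribute nothing.\<close>

lemma jacobi_weight_grid_zero:
  assumes "m < i" shows "jacobi_weight q i (q ^ m / q ^ i) = 0"
proof -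
  have "q * (q ^ m / q ^ i) * q ^ (i - m - 1) = 1"
    using assms q0 by (simp flip: power_Suc power_add)
  then have "qpoch (q * (q ^ m / q ^ i)) q i = 0"
    unfolding qpoch_def using assms by (auto simp: prod_zero_iff intro!: bexI[of _ "i - m - 1"])
  then show ?thesis by (simp add: jacobi_weight_def)
qed

lemma jacobi_weight_grid_nonneg: "jacobi_weight q i (q ^ m / q ^ i) \<ge> 0"
proof (cases "m \<ge> i")
  case True
  have "q * (q ^ m / q ^ i) * q ^ j \<le> 1" for j
    using True q0 pow_less_1[of "m - i + j"] by (simp add: power_diff power_add mult_ac)
  then show ?thesis
    unfolding jacobi_weight_def qpoch_def using q0 by (auto intro!: mult_nonneg_nonneg prod_nonneg)
next
  case False then show ?thesis using jacobi_weight_grid_zero[of m i] by simp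
qed

lemma energy_coef_pos: "i \<le> n \<Longrightarrow> energy_coef q n i > 0"
proof (induction i)
  case (Suc i) then show ?case using qder_eigenvalue_pos[of "Suc i" n] q0 by simp
qed simp

text \<open>The Pearson equation makes the difference equation self-adjoint (fact \<open>e\<close>),
  and a discrete product rule splits the energy difference into two fluxes. The eigenvalue in the
  lower one is cancelled by \<open>energy_coef\<close>.\<close>

lemma energy_step:
  assumes "x \<noteq> 0" "k < n"
  shows "energy q n (Suc k) x - energy q n (Suc k) (x / q) = flux q n (Suc k) x - flux q n k (q * x) / q"
proof -
  let ?g = "qder q (legp q n)"
  have nz: "x / q \<noteq> 0" using assms q0 by simp
  have L: "qder_eigenvalue q n (Suc k) > 0" using assms by (intro qder_eigenvalue_pos) auto
  have d: "?g (Suc k) x - ?g (Suc k) (x / q) = x / q * ?g (Suc (Suc k)) (x / q)"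
    using qder_Suc_mult[OF nz, of "legp q n" "Suc k"] q0 by simp
  have e: "jacobi_weight q (Suc k) x * ?g (Suc k) x - jacobi_weight q (Suc k) (x / q) * ?g (Suc k) (x / q)
      = - qder_eigenvalue q n (Suc k) * x * jacobi_weight q k x * ?g k x"
  proof -
    have "jacobi_weight q (Suc k) x * ?g (Suc k) x - jacobi_weight q (Suc k) (x / q) * ?g (Suc k) (x / q)
      = x * jacobi_weight q k x * ((1 - q ^ Suc k * x) * ?g (Suc k) x - (1 - x) * ?g (Suc k) (x / q) / q ^ Suc k)"
      unfolding jacobi_weight_Suc_div jacobi_weight_Suc[of k x] by (simp add: algebra_simps del: qder.simps power_Suc)
    then show ?thesis unfolding legp_qder_equation[OF assms(1)] by simp
  qed
  have "energy q n (Suc k) x - energy q n (Suc k) (x / q)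
    = energy_coef q n (Suc k) * ((jacobi_weight q (Suc k) x * ?g (Suc k) x - jacobi_weight q (Suc k) (x / q) * ?g (Suc k) (x / q)) * ?g (Suc k) x
      + jacobi_weight q (Suc k) (x / q) * ?g (Suc k) (x / q) * (?g (Suc k) x - ?g (Suc k) (x / q)))"
    unfolding energy_def by (simp add: algebra_simps power2_eq_square del: qder.simps)
  also have "\<dots> = flux q n (Suc k) x - flux q n k (q * x) / q"
    unfolding d e flux_def using q0 L by (simp add: field_simps del: qder.simps)
  finally show ?thesis .
qed

text \<open>This ends the telescoping over orders: off the grid the weight vanishes, on the grid the
  q-derivative of order \<open>n + 1\<close> does.\<close>

lemma flux_top: "flux q n n (q ^ Suc m / q ^ n) = 0"
proof (cases "m < n")
  case True
  then have "jacobi_weight q n (q ^ m / q ^ n) = 0" by (rule jacobi_weight_grid_zero)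
  then show ?thesis unfolding flux_def using q0 by simp
next
  case False
  then have "q ^ Suc m / q ^ n / q = q ^ (m - n)" using q0 by (simp add: power_diff)
  then show ?thesis unfolding flux_def using legp_qder_top[of n "m - n"] by (simp del: qder.simps)
qed

text \<open>After telescoping over the orders only the flux of order 0 survives; it completes the
  difference of squares to a perfect square.\<close>

lemma total_energy_step:
  "total_energy q n (q ^ Suc m) - total_energy q n (q ^ m) = (legp q n (q ^ Suc m) - legp q n (q ^ m))^2"
proof -
  define x where "x = q ^ Suc m"
  have x: "x \<noteq> 0" and xq: "q ^ m = x / q" using q0 by (auto simp: x_def)
  define f where "f k = q ^ k * flux q n k (x / q ^ k)" for k
  have *: "q ^ Suc k * energy q n (Suc k) (x / q ^ Suc k) - q ^ Suc k * energy q n (Suc k) (x / q / q ^ Suc k)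
     = f (Suc k) - f k" if "k < n" for k
  proof -
    have "x / q ^ Suc k \<noteq> 0" using x q0 by simp
    from energy_step[OF this that] have "energy q n (Suc k) (x / q ^ Suc k) - energy q n (Suc k) (x / q / q ^ Suc k)
      = flux q n (Suc k) (x / q ^ Suc k) - flux q n k (x / q ^ k) / q"
      using q0 by (simp add: mult_ac)
    then have "q ^ Suc k * (energy q n (Suc k) (x / q ^ Suc k) - energy q n (Suc k) (x / q / q ^ Suc k))
      = q ^ Suc k * (flux q n (Suc k) (x / q ^ Suc k) - flux q n k (x / q ^ k) / q)" by simp
    then show ?thesis unfolding f_def right_diff_distrib using q0 by simp
  qed
  have "(\<Sum>k<n. q ^ Suc k * energy q n (Suc k) (x / q ^ Suc k)) - (\<Sum>k<n. q ^ Suc k * energy q n (Suc k) (x / q / q ^ Suc k))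
     = (\<Sum>k<n. f (Suc k) - f k)"
    unfolding sum_subtractf[symmetric] by (intro sum.cong refl *) simp
  also have "\<dots> = f n - f 0" by (rule sum_lessThan_telescope)
  also have "f n = 0" unfolding f_def x_def flux_top by simp
  also have "f 0 = legp q n (x / q) * (legp q n x - legp q n (x / q))"
    unfolding f_def flux_def using x q0 by (simp add: jacobi_weight_def)
  finally have "total_energy q n x - total_energy q n (x / q) = (legp q n x)^2 - (legp q n (x / q))^2
     - 2 * (legp q n (x / q) * (legp q n x - legp q n (x / q)))"
    unfolding total_energy_def by (simp add: algebra_simps)
  then show ?thesis unfolding x_def[symmetric] xq by (simp add: power2_eq_square algebra_simps)
qed

section \<open>Limits along the grid and the resulting bound\<close>

lemma qder_polynomial: "\<exists>c. \<forall>x. x \<noteq> 0 \<longrightarrow> qder q (legp q n) i x = (\<Sum>j\<le>n. c j * x ^ j)"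
proof (induction i)
  case 0
  have "legp q n x = (\<Sum>j\<le>n. (lcoef q n j * q ^ j) * x ^ j)" for x
    by (subst legp_eq_sum[of n n]) (simp_all add: power_mult_distrib mult.assoc)
  then show ?case by (intro exI[of _ "\<lambda>j. lcoef q n j * q ^ j"]) simp
next
  case (Suc i)
  then obtain c where c: "\<And>x. x \<noteq> 0 \<Longrightarrow> qder q (legp q n) i x = (\<Sum>j\<le>n. c j * x ^ j)" by blast
  \<comment> \<open>Padding with 0 at \<open>j = n\<close> keeps the same degree bound throughout
    the induction.\<close>
  define c' where "c' j = (if j < n then c (Suc j) * (q ^ Suc j - 1) else 0)" for j
  have "qder q (legp q n) (Suc i) x = (\<Sum>j\<le>n. c' j * x ^ j)" if x: "x \<noteq> 0" for x
  proof -
    have "x * qder q (legp q n) (Suc i) x = (\<Sum>j\<le>n. c j * (q * x) ^ j) - (\<Sum>j\<le>n. c j * x ^ j)"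
      using qder_Suc_mult[OF x] c[OF x] c[of "q * x"] x q0 by simp
    also have "\<dots> = (\<Sum>j\<le>n. c j * (q ^ j - 1) * x ^ j)"
      by (simp add: sum_subtractf[symmetric] algebra_simps power_mult_distrib)
    also have "\<dots> = (\<Sum>j<n. c (Suc j) * (q ^ Suc j - 1) * x ^ Suc j)"
      by (subst sum.atMost_shift) simp
    also have "\<dots> = x * (\<Sum>j<n. c' j * x ^ j)"
      unfolding sum_distrib_left by (intro sum.cong) (auto simp: c'_def)
    also have "(\<Sum>j<n. c' j * x ^ j) = (\<Sum>j\<le>n. c' j * x ^ j)"
      by (simp add: lessThan_Suc_atMost[symmetric] c'_def)
    finally show ?thesis using x by (simp del: qder.simps)
  qed
  then show ?case by blast
qed

lemma legp_tendsto_1: "(\<lambda>m. legp q n (q ^ m)) \<longlonglongrightarrow> 1"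
proof -
  have q: "(\<lambda>m. q ^ m) \<longlonglongrightarrow> 0" using q0 q1 by (intro LIMSEQ_realpow_zero) auto
  have "(\<lambda>m. \<Sum>j\<le>n. lcoef q n j * (q * q ^ m) ^ j) \<longlonglongrightarrow> (\<Sum>j\<le>n. lcoef q n j * (q * 0) ^ j)"
    by (intro tendsto_intros q)
  then show ?thesis
    unfolding legp_eq_sum[OF order_refl, symmetric] legp_at_0 by simp
qed

text \<open>The weight contains \<open>x ^ Suc k\<close>, which tends to 0, while all other factors
  converge. Shifting \<open>m\<close> by \<open>Suc k\<close> cancels the division in the
  argument.\<close>

lemma energy_tendsto_0: "(\<lambda>m. energy q n (Suc k) (q ^ m / q ^ Suc k)) \<longlonglongrightarrow> 0"
proof -
  have q: "(\<lambda>m. q ^ m) \<longlonglongrightarrow> 0" using q0 q1 by (intro LIMSEQ_realpow_zero) auto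
  obtain c where c: "\<And>x. x \<noteq> 0 \<Longrightarrow> qder q (legp q n) (Suc k) x = (\<Sum>j\<le>n. c j * x ^ j)"
    using qder_polynomial[of n "Suc k"] by blast
  have eq: "energy q n (Suc k) (q ^ (m + Suc k) / q ^ Suc k)
     = energy_coef q n (Suc k) * ((q ^ m) ^ Suc k * (\<Prod>j<Suc k. 1 - q * q ^ m * q ^ j)) * (\<Sum>j\<le>n. c j * (q ^ m) ^ j)^2" for m
  proof -
    have div: "q ^ (m + Suc k) / q ^ Suc k = q ^ m" and nz: "q ^ m \<noteq> 0"
      using q0 by (simp_all add: power_add)
    show ?thesis unfolding div energy_def jacobi_weight_def qpoch_def c[OF nz] ..
  qed
  have "(\<lambda>m. energy_coef q n (Suc k) * ((q ^ m) ^ Suc k * (\<Prod>j<Suc k. 1 - q * q ^ m * q ^ j)) * (\<Sum>j\<le>n. c j * (q ^ m) ^ j)^2)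
     \<longlonglongrightarrow> energy_coef q n (Suc k) * (0 ^ Suc k * (\<Prod>j<Suc k. 1 - q * 0 * q ^ j)) * (\<Sum>j\<le>n. c j * 0 ^ j)^2"
    by (intro tendsto_intros q)
  then have "(\<lambda>m. energy q n (Suc k) (q ^ (m + Suc k) / q ^ Suc k)) \<longlonglongrightarrow> 0"
    unfolding eq by (simp only: power_0_Suc mult_zero_left mult_zero_right)
  then show ?thesis by (rule LIMSEQ_offset)
qed

lemma abs_legp_le_1: "\<bar>legp q n (q ^ m)\<bar> \<le> 1"
proof -
  have "total_energy q n (q ^ m) \<le> total_energy q n (q ^ Suc m)" for m
    using total_energy_step[of n m] zero_le_power2[of "legp q n (q ^ Suc m) - legp q n (q ^ m)"] by linarith
  then have inc: "incseq (\<lambda>m. total_energy q n (q ^ m))" by (intro incseq_SucI)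
  have "(\<lambda>m. total_energy q n (q ^ m)) \<longlonglongrightarrow> 1^2 + 2 * (\<Sum>k<n. q ^ Suc k * 0)"
    unfolding total_energy_def by (intro tendsto_intros legp_tendsto_1 energy_tendsto_0)
  then have "total_energy q n (q ^ m) \<le> 1" using incseq_le[OF inc] by simp
  moreover have "(\<Sum>k<n. q ^ Suc k * energy q n (Suc k) (q ^ m / q ^ Suc k)) \<ge> 0"
    unfolding energy_def using q0 jacobi_weight_grid_nonneg[of "Suc _" m] energy_coef_pos[of "Suc _" n]
    by (intro sum_nonneg mult_nonneg_nonneg) (auto simp: less_imp_le Suc_le_eq simp del: qder.simps power_Suc energy_coef.simps)
  ultimately have "(legp q n (q ^ m))^2 \<le> 1" unfolding total_energy_def by simp
  then show ?thesis by (simp add: abs_square_le_1)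
qed

section \<open>Decay and orthogonality in the degree\<close>

text \<open>With the induction hypothesis the recurrence at \<open>x = 1\<close> becomes first
  order. Iteration gives \<open>(-1)^n * q^(n*(n+1)/2)\<close>, the starting point for the decay at
  all grid points.\<close>

lemma legp_at_1_Suc: "legp q (Suc n) 1 = - (q ^ Suc n) * legp q n 1"
proof (induction n)
  case 0
  have "recur_coef q 1 * (legp q 1 1 - 1) = - (1 - q)"
    using legp_recurrence[of 0 1] by (simp add: recur_coef_def haar_wt_def)
  then have "(1 - q) * ((legp q 1 1 - 1) / (1 + q)) = (1 - q) * (- 1)" by (simp add: recur_coef_def)
  then have "(legp q 1 1 - 1) / (1 + q) = - 1" using q1 by (metis diff_gt_0_iff_gt less_irrefl mult_left_cancel)
  then show ?case using q0 by (simp add: divide_eq_eq split: if_splits)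
next
  case (Suc n)
  define Q where "Q = q ^ Suc n"
  have Q: "0 < Q" "q * Q < 1" using q0 pow_less_1[of "Suc n"] by (auto simp: Q_def)
  define a b c where "a = legp q n 1" and "b = legp q (Suc n) 1" and "c = legp q (Suc (Suc n)) 1"
  have b: "b = - Q * a" using Suc by (simp add: a_def b_def Q_def)
  have "(1 - q * Q) / (1 + q * Q) * (c - b) = (1 - Q) / (1 + Q) * (b - a) - (1 - Q * Q * q) / Q * b"
  proof -
    have "q ^ (2 * Suc n + 1) = Q * Q * q" unfolding Q_def by (simp add: power_add mult_2)
    then show ?thesis using legp_recurrence[of "Suc n" 1] unfolding recur_coef_def haar_wt_def a_def b_def c_def
      by (simp add: Q_def)
  qed
  also have "(1 - Q) / (1 + Q) * (b - a) = - (1 - Q) * a"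
    unfolding b using Q by (simp add: field_simps)
  also have "- (1 - Q) * a - (1 - Q * Q * q) / Q * b = Q * (1 - q * Q) * a"
    unfolding b using Q by (simp add: field_simps)
  finally have "(1 - q * Q) * ((c - b) / (1 + q * Q)) = (1 - q * Q) * (Q * a)" by (simp add: mult_ac)
  then have "(c - b) / (1 + q * Q) = Q * a" using Q by (metis diff_gt_0_iff_gt less_irrefl mult_left_cancel)
  moreover have "1 + q * Q > 0" using Q q0 by (simp add: add_pos_pos)
  ultimately have "c - b = Q * a * (1 + q * Q)" by (simp add: divide_eq_eq)
  then have "c = - (q * Q) * b" unfolding b by (simp add: algebra_simps)
  then show ?case by (simp add: b_def c_def Q_def)
qed

section \<open>Sequences decaying faster than every exponential\<close>

lemma rapidI: "(\<And>N. \<exists>C. \<forall>k. \<bar>f k\<bar> \<le> C * q ^ (N * k)) \<Longrightarrow> rapid q f"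
  by (simp add: rapid_def)

lemma rapidD:
  assumes "rapid q f" obtains C where "C \<ge> 0" "\<And>k. \<bar>f k\<bar> \<le> C * q ^ (N * k)"
proof -
  obtain C where C: "\<And>k. \<bar>f k\<bar> \<le> C * q ^ (N * k)" using assms unfolding rapid_def by blast
  have "0 \<le> \<bar>f 0\<bar>" by simp
  also have "\<dots> \<le> C" using C[of 0] by simp
  finally show thesis using that C by blast
qed

lemma rapid_add: assumes "rapid q f" "rapid q g" shows "rapid q (\<lambda>k. f k + g k)"
proof (rule rapidI)
  fix N
  obtain C where C: "\<And>k. \<bar>f k\<bar> \<le> C * q ^ (N * k)" using rapidD[OF assms(1)] by blast
  obtain D where D: "\<And>k. \<bar>g k\<bar> \<le> D * q ^ (N * k)" using rapidD[OF assms(2)] by blast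
  have "\<bar>f k + g k\<bar> \<le> (C + D) * q ^ (N * k)" for k
    using C[of k] D[of k] by (simp add: distrib_right abs_le_iff)
  then show "\<exists>C. \<forall>k. \<bar>f k + g k\<bar> \<le> C * q ^ (N * k)" by blast
qed

lemma rapid_mult:
  assumes "rapid q f" and g: "\<And>k. \<bar>g k\<bar> \<le> B / q ^ k"
  shows "rapid q (\<lambda>k. g k * f k)"
proof (rule rapidI)
  fix N
  obtain C where C: "C \<ge> 0" "\<And>k. \<bar>f k\<bar> \<le> C * q ^ (Suc N * k)" using rapidD[OF assms(1)] by blast
  have "\<bar>g k * f k\<bar> \<le> (B * C) * q ^ (N * k)" for k
  proof -
    have "\<bar>g k * f k\<bar> \<le> (B / q ^ k) * (C * q ^ (Suc N * k))"
      unfolding abs_mult using C g[of k] by (intro mult_mono) (auto intro: order_trans[OF abs_ge_zero])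
    also have "\<dots> = (B * C) * q ^ (N * k)" using q0 by (simp add: power_add)
    finally show ?thesis .
  qed
  then show "\<exists>C. \<forall>k. \<bar>g k * f k\<bar> \<le> C * q ^ (N * k)" by blast
qed

lemma bounded_le_div_pow: assumes "\<bar>a\<bar> \<le> B" shows "\<bar>a\<bar> \<le> B / q ^ k"
proof -
  have "B * q ^ k \<le> B * 1" using assms q0 q1 by (intro mult_left_mono power_le_one) auto
  then have "B \<le> B / q ^ k" using q0 by (simp add: le_divide_eq)
  then show ?thesis using assms by linarith
qed

lemma rapid_bounded_mult: "rapid q f \<Longrightarrow> (\<And>k. \<bar>g k\<bar> \<le> B) \<Longrightarrow> rapid q (\<lambda>k. g k * f k)"
  using rapid_mult bounded_le_div_pow by metis

lemma rapid_summable_abs: assumes "rapid q f" shows "summable (\<lambda>k. \<bar>f k\<bar>)"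
proof -
  obtain C where C: "\<And>k. \<bar>f k\<bar> \<le> C * q ^ (1 * k)" using rapidD[OF assms] by blast
  have "summable (\<lambda>k. C * q ^ k)" using q0 q1 by (intro summable_mult summable_geometric) simp
  then show ?thesis by (rule summable_comparison_test'[where N = 0]) (use C in simp)
qed

lemma rapid_summable: "rapid q f \<Longrightarrow> summable f"
  using rapid_summable_abs summable_rabs_cancel by blast

lemma haar_wt_eq: "haar_wt q n = (1 - q * (q ^ n * q ^ n)) / q ^ n"
  by (simp add: haar_wt_def power_add mult_2)

lemma haar_wt_pos: "haar_wt q k > 0"
  unfolding haar_wt_def using q0 pow_less_1[of "2 * k"] by simp

lemma haar_wt_le: "haar_wt q k \<le> 1 / q ^ k"
  unfolding haar_wt_def using q0 by (intro divide_right_mono) auto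

lemma legp_eigenvalue_nonneg: "legp_eigenvalue q k \<ge> 0"
  unfolding legp_eigenvalue_def using q0 q1 pow_less_1[of k] by (simp add: power_le_one)

lemma legp_eigenvalue_le: "legp_eigenvalue q k \<le> 1 / q ^ k"
proof -
  have "(1 - q ^ k) * (1 - q ^ (k+1)) \<le> 1 * 1"
    using q0 q1 by (intro mult_mono) (simp_all add: power_le_one flip: power_Suc)
  then show ?thesis unfolding legp_eigenvalue_def using q0 by (intro divide_right_mono) auto
qed

text \<open>The truncated \<open>m - 1\<close> is harmless at \<open>m = 0\<close>, where its
  coefficient \<open>1 - q ^ m\<close> vanishes.\<close>

lemma legp_qdiff_grid:
  "(1 - q ^ Suc m) * (legp q k (q ^ Suc m) - legp q k (q ^ m))
   = (1 - q ^ m) * (legp q k (q ^ m) - legp q k (q ^ (m-1))) - legp_eigenvalue q k * q ^ m * legp q k (q ^ m)"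
  using legp_qdiff[of "q ^ m" k] q0 by (cases m) simp_all

text \<open>The difference equation expresses the values at \<open>q ^ Suc j\<close> by those at
  \<open>q ^ j\<close> and \<open>q ^ (j-1)\<close>, with coefficients of order at most
  \<open>1 / q ^ k\<close>, which rapid decay absorbs.\<close>

lemma rapid_legp: "rapid q (\<lambda>k. legp q k (q ^ m))"
proof (induction m rule: less_induct)
  case (less m)
  show ?case
  proof (cases m)
    case 0
    show ?thesis unfolding 0 power_0
    proof (rule rapidI)
      fix N
      \<comment> \<open>The constant makes the bound at least 1 up to \<open>k = N\<close>; after
        that each step gains a factor of at most \<open>q ^ N\<close>.\<close>
      have "\<bar>legp q k 1\<bar> \<le> (1 / q ^ (N * N)) * q ^ (N * k)" for k
      proof (induction k)
        case 0 show ?case using q0 q1 by (simp add: power_le_one)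
      next
        case (Suc k)
        show ?case
        proof (cases "Suc k \<le> N")
          case True
          have "q ^ (N * N) \<le> q ^ (N * Suc k)" using mult_le_mono2[OF True, of N] q0 q1 by (intro power_decreasing) auto
          then have "1 \<le> (1 / q ^ (N * N)) * q ^ (N * Suc k)" using q0 by simp
          then show ?thesis using abs_legp_le_1[of "Suc k" 0] by simp
        next
          case False
          then have "q ^ Suc k \<le> q ^ N" using q0 q1 by (intro power_decreasing) auto
          then have "q ^ Suc k * \<bar>legp q k 1\<bar> \<le> q ^ N * ((1 / q ^ (N * N)) * q ^ (N * k))"
            using Suc q0 by (intro mult_mono) auto
          then show ?thesis unfolding legp_at_1_Suc using q0 by (simp add: abs_mult power_add mult_ac)
        qed
      qed
      then show "\<exists>C. \<forall>k. \<bar>legp q k 1\<bar> \<le> C * q ^ (N * k)" by blast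
    qed
  next
    case (Suc j)
    let ?d = "1 - q ^ Suc j"
    have d: "?d > 0" using pow_less_1[of j] by simp
    have eq: "legp q k (q ^ Suc j) = legp q k (q ^ j) + (1 - q ^ j) / ?d * legp q k (q ^ j)
       + - (1 - q ^ j) / ?d * legp q k (q ^ (j-1)) + (- (q ^ j) / ?d * legp_eigenvalue q k) * legp q k (q ^ j)" for k
    proof -
      have "legp q k (q ^ Suc j) = legp q k (q ^ j)
        + ((1 - q ^ j) * (legp q k (q ^ j) - legp q k (q ^ (j-1))) - legp_eigenvalue q k * q ^ j * legp q k (q ^ j)) / ?d"
        unfolding legp_qdiff_grid[symmetric] using d by simp
      moreover have "(a * (u - v) - l * b * u) / d = a / d * u + - a / d * v + (- b / d * l) * u"
        for a b d l u v :: real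
        by (simp add: diff_divide_distrib right_diff_distrib mult_ac)
      ultimately show ?thesis by (simp only: add.assoc)
    qed
    have IH: "rapid q (\<lambda>k. legp q k (q ^ j))" "rapid q (\<lambda>k. legp q k (q ^ (j-1)))"
      using Suc by (auto intro!: less.IH)
    have bound: "\<bar>- (q ^ j) / ?d * legp_eigenvalue q k\<bar> \<le> (q ^ j / ?d) / q ^ k" for k
      using mult_left_mono[OF legp_eigenvalue_le[of k], of "q ^ j / ?d"] legp_eigenvalue_nonneg[of k] q0 d by (simp add: abs_mult)
    show ?thesis
      unfolding Suc eq by (intro rapid_add rapid_bounded_mult[OF IH(1) order_refl]
        rapid_bounded_mult[OF IH(2) order_refl] rapid_mult[OF IH(1) bound] IH)
  qed
qed

lemma legp_degree_tendsto_0: "(\<lambda>k. legp q k (q ^ m)) \<longlonglongrightarrow> 0"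
  using rapid_legp by (intro summable_LIMSEQ_zero rapid_summable)

lemma rapid_haar_wt: "rapid q f \<Longrightarrow> rapid q (\<lambda>k. f k * haar_wt q k)"
  using rapid_mult[of f "haar_wt q" 1] haar_wt_le haar_wt_pos by (simp add: mult.commute less_imp_le)

lemma rapid_legp_prod: "rapid q (\<lambda>k. legp q k (q ^ a) * legp q k (q ^ b))"
  by (rule rapid_bounded_mult[OF rapid_legp abs_legp_le_1])

section \<open>Orthogonality and square sums\<close>

lemma recur_coef_bounds: "0 \<le> recur_coef q n" "recur_coef q n \<le> 1 - q ^ n"
proof -
  have "q ^ n > 0" "q ^ n \<le> 1" using q0 q1 by (auto simp: power_le_one)
  moreover from this have "(1 - q ^ n) * 1 \<le> (1 - q ^ n) * (1 + q ^ n)" by (intro mult_left_mono) auto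
  ultimately show "0 \<le> recur_coef q n" "recur_coef q n \<le> 1 - q ^ n"
    unfolding recur_coef_def by (auto simp: divide_le_eq)
qed

lemma recur_coef_Suc_pos: "recur_coef q (Suc n) > 0"
  unfolding recur_coef_def using pow_less_1[of n] q0 by (intro divide_pos_pos add_pos_pos) auto

lemma legp_orthogonal:
  assumes "a \<noteq> b"
  shows "(\<lambda>k. legp q k (q ^ a) * legp q k (q ^ b) * haar_wt q k) sums 0"
proof -
  define Y where "Y m k = legp q k (q ^ m)" for m k
  define D where "D m k = recur_coef q k * (Y m k - Y m (k-1))" for m k
  \<comment> \<open>The discrete Wronskian of the two solutions.\<close>
  define W where "W k = D a k * Y b k - D b k * Y a k" for k
  have D: "D m (Suc k) = D m k - q ^ m * haar_wt q k * Y m k" for m k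
    using legp_recurrence[of k "q ^ m"] by (simp add: D_def Y_def)
  \<comment> \<open>Replacing \<open>Y (Suc k)\<close> by \<open>Y k\<close> changes both products
    by the same product of differences, which cancels.\<close>
  have W': "W (Suc k) = D a (Suc k) * Y b k - D b (Suc k) * Y a k" for k
    unfolding W_def D_def by (simp add: algebra_simps)
  have step: "W k - W (Suc k) = (q ^ a - q ^ b) * (Y a k * Y b k * haar_wt q k)" for k
    unfolding W' unfolding W_def D by (simp add: algebra_simps)
  have "W \<longlonglongrightarrow> 0"
  proof (rule tendsto_0_le[where K = 1])
    show "\<forall>\<^sub>F k in sequentially. norm (W k) \<le> norm (\<bar>Y a k\<bar> + \<bar>Y b k\<bar>) * 1"
    proof (rule always_eventually, rule allI)
      fix k
      have W: "W k = recur_coef q k * (Y b (k-1) * Y a k - Y a (k-1) * Y b k)"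
        unfolding W_def D_def by (simp add: algebra_simps)
      have s: "\<bar>recur_coef q k\<bar> \<le> 1" using recur_coef_bounds[of k] q0 zero_less_power[OF q0, of k] by linarith
      have "\<bar>Y b (k-1) * Y a k - Y a (k-1) * Y b k\<bar> \<le> \<bar>Y b (k-1) * Y a k\<bar> + \<bar>Y a (k-1) * Y b k\<bar>"
        by (rule abs_triangle_ineq4)
      also have "\<dots> \<le> 1 * \<bar>Y a k\<bar> + 1 * \<bar>Y b k\<bar>"
        unfolding abs_mult Y_def by (intro add_mono mult_right_mono abs_legp_le_1) auto
      finally have "\<bar>recur_coef q k\<bar> * \<bar>Y b (k-1) * Y a k - Y a (k-1) * Y b k\<bar> \<le> 1 * (\<bar>Y a k\<bar> + \<bar>Y b k\<bar>)"
        using s by (intro mult_mono) auto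
      then show "norm (W k) \<le> norm (\<bar>Y a k\<bar> + \<bar>Y b k\<bar>) * 1" unfolding W by (simp add: abs_mult)
    qed
    show "(\<lambda>k. \<bar>Y a k\<bar> + \<bar>Y b k\<bar>) \<longlonglongrightarrow> 0"
      unfolding Y_def using tendsto_add[OF tendsto_rabs_zero[OF legp_degree_tendsto_0[of a]] tendsto_rabs_zero[OF legp_degree_tendsto_0[of b]]]
      by simp
  qed
  \<comment> \<open>The starting value \<open>W 0\<close> is 0 because
    \<open>recur_coef q 0 = 0\<close>.\<close>
  from telescope_sums'[OF this] have "(\<lambda>k. (q ^ a - q ^ b) * (Y a k * Y b k * haar_wt q k)) sums 0"
    unfolding step by (simp add: W_def D_def recur_coef_def)
  from sums_mult[OF this, of "1 / (q ^ a - q ^ b)"] show ?thesis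
    using assms q0 q1 power_inject_exp'[of q a b] by (simp add: Y_def)
qed

lemma legp_sum_squares: "(\<lambda>k. (legp q k (q ^ m))^2 * haar_wt q k) sums (1 / q ^ m)"
proof (induction m)
  case 0
  define F where "F k = (legp q k 1)^2 / q ^ k" for k
  have "rapid q (\<lambda>k. (1 / q ^ k) * (legp q k 1 * legp q k 1))"
    using rapid_mult[of "\<lambda>k. legp q k 1 * legp q k 1" "\<lambda>k. 1 / q ^ k" 1] rapid_legp_prod[of 0 0] q0 by simp
  from summable_LIMSEQ_zero[OF rapid_summable[OF this]] have "F \<longlonglongrightarrow> 0"
    unfolding F_def[abs_def] by (simp add: power2_eq_square)
  then have "(\<lambda>k. F k - F (Suc k)) sums (F 0 - 0)" by (rule telescope_sums')
  moreover have "F k - F (Suc k) = (legp q k 1)^2 * haar_wt q k" for k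
  proof -
    have "(legp q (Suc k) 1)^2 / q ^ Suc k = q ^ Suc k * (legp q k 1)^2"
      unfolding legp_at_1_Suc using q0 by (simp add: power2_eq_square)
    then show ?thesis unfolding F_def haar_wt_eq using q0
      by (simp add: field_simps power2_eq_square)
  qed
  ultimately show ?case by (simp add: F_def)
next
  case (Suc m)
  define Y where "Y a k = legp q k (q ^ a)" for a k
  have IH: "(\<lambda>k. Y m k * Y m k * haar_wt q k) sums (1 / q ^ m)"
    using Suc by (simp add: Y_def power2_eq_square)
  have orth: "(\<lambda>k. Y a k * Y b k * haar_wt q k) sums 0" if "a \<noteq> b" for a b
    using legp_orthogonal[OF that] by (simp add: Y_def)
  have "summable (\<lambda>k. Y (Suc m) k * Y (Suc m) k * haar_wt q k)"
    unfolding Y_def by (intro rapid_summable rapid_haar_wt rapid_legp_prod)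
  then obtain S where S: "(\<lambda>k. Y (Suc m) k * Y (Suc m) k * haar_wt q k) sums S" by (auto simp: summable_def)
  \<comment> \<open>\<open>L\<close> is the difference operator applied to \<open>Y m\<close>,
    paired with \<open>q * Y (Suc m)\<close>. By the eigenvalue equation it equals the operator
    applied to \<open>Y (Suc m)\<close>, paired with \<open>Y m\<close>. Orthogonality leaves one
    square sum on either side.\<close>
  define L where "L k = q * (1 - q ^ Suc m) * (Y m k * Y (Suc m) k * haar_wt q k - Y (Suc m) k * Y (Suc m) k * haar_wt q k)
     + q * (1 - q ^ m) * (Y m k * Y (Suc m) k * haar_wt q k - Y (m-1) k * Y (Suc m) k * haar_wt q k)" for k
  have L1: "L sums (q * (1 - q ^ Suc m) * (0 - S) + q * (1 - q ^ m) * (0 - 0))"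
    unfolding L_def by (intro sums_add sums_mult sums_diff orth S) auto
  have "L = (\<lambda>k. (1 - q ^ Suc (Suc m)) * (Y (Suc m) k * Y m k * haar_wt q k - Y (Suc (Suc m)) k * Y m k * haar_wt q k)
     + (1 - q ^ Suc m) * (Y (Suc m) k * Y m k * haar_wt q k - Y m k * Y m k * haar_wt q k))"
  proof
    fix k
    have e1: "(1 - q ^ Suc m) * (Y m k - Y (Suc m) k) + (1 - q ^ m) * (Y m k - Y (m-1) k) = legp_eigenvalue q k * q ^ m * Y m k"
      using legp_qdiff_grid[of m k] by (simp add: Y_def algebra_simps)
    have e2: "(1 - q ^ Suc (Suc m)) * (Y (Suc m) k - Y (Suc (Suc m)) k) + (1 - q ^ Suc m) * (Y (Suc m) k - Y m k)
       = legp_eigenvalue q k * q ^ Suc m * Y (Suc m) k"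
      using legp_qdiff_grid[of "Suc m" k] by (simp add: Y_def algebra_simps)
    have "L k = q * ((1 - q ^ Suc m) * (Y m k - Y (Suc m) k) + (1 - q ^ m) * (Y m k - Y (m-1) k)) * Y (Suc m) k * haar_wt q k"
      unfolding L_def by (simp add: algebra_simps)
    also have "\<dots> = ((1 - q ^ Suc (Suc m)) * (Y (Suc m) k - Y (Suc (Suc m)) k) + (1 - q ^ Suc m) * (Y (Suc m) k - Y m k)) * Y m k * haar_wt q k"
      unfolding e1 e2 by simp
    finally show "L k = (1 - q ^ Suc (Suc m)) * (Y (Suc m) k * Y m k * haar_wt q k - Y (Suc (Suc m)) k * Y m k * haar_wt q k)
     + (1 - q ^ Suc m) * (Y (Suc m) k * Y m k * haar_wt q k - Y m k * Y m k * haar_wt q k)"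
      by (simp add: algebra_simps)
  qed
  also have "\<dots> sums ((1 - q ^ Suc (Suc m)) * (0 - 0) + (1 - q ^ Suc m) * (0 - 1 / q ^ m))"
    by (intro sums_add sums_mult sums_diff orth IH) auto
  finally have "q * (1 - q ^ Suc m) * (0 - S) + q * (1 - q ^ m) * (0 - 0)
     = (1 - q ^ Suc (Suc m)) * (0 - 0) + (1 - q ^ Suc m) * (0 - 1 / q ^ m)"
    using L1 sums_unique2 by blast
  then have "(1 - q ^ Suc m) * (q * S) = (1 - q ^ Suc m) * (1 / q ^ m)" by (simp add: mult_ac)
  moreover have "1 - q ^ Suc m \<noteq> 0" using pow_less_1[of m] by simp
  ultimately have "q * S = 1 / q ^ m" by (metis mult_left_cancel)
  then have "S = 1 / q ^ Suc m" using q0 by (simp add: field_simps)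
  then show ?case using S by (simp add: Y_def power2_eq_square)
qed

text \<open>Supplies strictness in the lower norm inequality. Otherwise all absolute values would be
  0 or at least 1, hence eventually 0 by convergence; running the recurrence backwards would then
  force the value 0 in degree 0, where it is 1.\<close>

lemma abs_legp_interior: "\<exists>k. 0 < \<bar>legp q k (q ^ m)\<bar> \<and> \<bar>legp q k (q ^ m)\<bar> < 1"
proof (rule ccontr)
  assume neg: "\<nexists>k. 0 < \<bar>legp q k (q ^ m)\<bar> \<and> \<bar>legp q k (q ^ m)\<bar> < 1"
  have "\<forall>\<^sub>F k in sequentially. \<bar>legp q k (q ^ m)\<bar> < 1"
    using tendsto_rabs_zero[OF legp_degree_tendsto_0[of m]] by (rule order_tendstoD) simp
  then obtain K where "\<And>k. k \<ge> K \<Longrightarrow> \<bar>legp q k (q ^ m)\<bar> < 1" by (auto simp: eventually_sequentially)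
  with neg have "\<forall>k\<ge>K. legp q k (q ^ m) = 0" by auto
  then have "\<forall>k\<ge>0. legp q k (q ^ m) = 0"
  proof (induction K)
    case (Suc K)
    have "recur_coef q (Suc K) * legp q K (q ^ m) = 0"
      using legp_recurrence[of "Suc K" "q ^ m"] Suc.prems by simp
    then have "legp q K (q ^ m) = 0" using recur_coef_Suc_pos[of K] by simp
    then have "\<forall>k\<ge>K. legp q k (q ^ m) = 0" using Suc.prems by (metis Suc_leI le_neq_implies_less)
    then show ?case by (rule Suc.IH)
  qed
  from this[rule_format, of 0] show False by simp
qed

lemma sum_squares_less_sum_abs:
  "(\<Sum>k. (legp q k (q ^ m))^2 * haar_wt q k) < (\<Sum>k. \<bar>legp q k (q ^ m)\<bar> * haar_wt q k)"
proof -
  let ?Y = "\<lambda>k. legp q k (q ^ m)"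
  have s1: "summable (\<lambda>k. \<bar>?Y k\<bar> * haar_wt q k)"
    using rapid_summable_abs[OF rapid_haar_wt[OF rapid_legp]] haar_wt_pos by (simp add: abs_mult abs_of_pos)
  have s2: "summable (\<lambda>k. (?Y k)^2 * haar_wt q k)"
    using legp_sum_squares by (rule sums_summable)
  have e: "\<bar>?Y k\<bar> * haar_wt q k - (?Y k)^2 * haar_wt q k = \<bar>?Y k\<bar> * (1 - \<bar>?Y k\<bar>) * haar_wt q k" for k
  proof -
    have "(?Y k)^2 = \<bar>?Y k\<bar> * \<bar>?Y k\<bar>" by (simp add: power2_eq_square)
    then show ?thesis by (simp add: algebra_simps)
  qed
  obtain i where i: "0 < \<bar>?Y i\<bar>" "\<bar>?Y i\<bar> < 1" using abs_legp_interior by blast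
  have "0 < (\<Sum>k. \<bar>?Y k\<bar> * haar_wt q k - (?Y k)^2 * haar_wt q k)"
  proof (rule suminf_pos2[where i = i])
    show "summable (\<lambda>k. \<bar>?Y k\<bar> * haar_wt q k - (?Y k)^2 * haar_wt q k)" by (rule summable_diff[OF s1 s2])
    show "0 \<le> \<bar>?Y k\<bar> * haar_wt q k - (?Y k)^2 * haar_wt q k" for k
      unfolding e using abs_legp_le_1[of k m] haar_wt_pos[of k] by (intro mult_nonneg_nonneg) auto
    show "0 < \<bar>?Y i\<bar> * haar_wt q i - (?Y i)^2 * haar_wt q i"
      unfolding e using i haar_wt_pos[of i] by (intro mult_pos_pos) auto
  qed
  then show ?thesis unfolding suminf_diff[OF s1 s2, symmetric] by simp
qed

section \<open>Decay beyond the turning point\<close>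

text \<open>Both values of \<open>recur_coef\<close> are at most \<open>e = 1 - q ^ (2*n+1)\<close>,
  while \<open>q ^ m * haar_wt q n\<close> is \<open>e / t\<close> with
  \<open>t = q ^ n / q ^ m \<le> 1/4\<close>. The first bound yields monotonicity, the second the
  decay rate.\<close>

lemma haar_wt_lower_bound:
  assumes "4 * q ^ n \<le> q ^ m"
  shows "2 * recur_coef q n + 2 * recur_coef q (Suc n) \<le> q ^ m * haar_wt q n"
    and "recur_coef q n \<le> 4 * q ^ n / q ^ m * (q ^ m * haar_wt q n - recur_coef q n - 2 * recur_coef q (Suc n))"
proof -
  define e where "e = 1 - q ^ (2*n+1)"
  have e: "e > 0" unfolding e_def using pow_less_1[of "2*n"] by simp
  have "q ^ (2*n+1) \<le> q ^ n" "q ^ (2*n+1) \<le> q ^ Suc n" using q0 q1 by (intro power_decreasing; simp)+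
  then have s: "recur_coef q n \<le> e" "recur_coef q (Suc n) \<le> e"
    using recur_coef_bounds[of n] recur_coef_bounds[of "Suc n"] unfolding e_def by linarith+
  define t where "t = q ^ n / q ^ m"
  have t: "0 < t" "4 * t \<le> 1" unfolding t_def using q0 assms by (auto simp: divide_le_eq)
  have x: "q ^ m * haar_wt q n = e / t" unfolding t_def haar_wt_def e_def by simp
  have "4 * e * t \<le> e" using t e mult_left_mono[of "4 * t" 1 e] by (simp add: mult_ac)
  then have "4 * e \<le> e / t" using t by (simp add: le_divide_eq)
  then show "2 * recur_coef q n + 2 * recur_coef q (Suc n) \<le> q ^ m * haar_wt q n"
    proof -
    have "2 * recur_coef q n + 2 * recur_coef q (Suc n) \<le> 4 * e" using s by simp
    then show ?thesis unfolding x using \<open>4 * e \<le> e / t\<close> by (rule order_trans)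
  qed
  have "4 * t * (recur_coef q n + 2 * recur_coef q (Suc n)) \<le> 1 * (recur_coef q n + 2 * recur_coef q (Suc n))"
    using t recur_coef_bounds[of n] recur_coef_bounds[of "Suc n"] by (intro mult_right_mono) auto
  then have "4 * t * (e / t - recur_coef q n - 2 * recur_coef q (Suc n)) \<ge> 4 * e - (recur_coef q n + 2 * recur_coef q (Suc n))"
    using t by (simp add: algebra_simps)
  then show "recur_coef q n \<le> 4 * q ^ n / q ^ m * (q ^ m * haar_wt q n - recur_coef q n - 2 * recur_coef q (Suc n))"
    unfolding x using s t_def by simp
qed

text \<open>Otherwise the sequence would grow from \<open>n\<close> on, contradicting its convergence to 0.\<close>

lemma abs_legp_antimono:
  assumes "4 * q ^ n \<le> q ^ m"
  shows "\<bar>legp q n (q ^ m)\<bar> \<le> \<bar>legp q (n-1) (q ^ m)\<bar>"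
proof (rule ccontr)
  assume neg: "\<not> \<bar>legp q n (q ^ m)\<bar> \<le> \<bar>legp q (n-1) (q ^ m)\<bar>"
  define Y where "Y k = legp q k (q ^ m)" for k
  have gt: "\<bar>Y (n-1)\<bar> < \<bar>Y n\<bar>" using neg by (simp add: Y_def)
  have grow: "\<bar>Y (k-1)\<bar> \<le> \<bar>Y k\<bar> \<and> \<bar>Y n\<bar> \<le> \<bar>Y k\<bar>" if "n \<le> k" for k
    using that
  proof (induction rule: dec_induct)
    case base then show ?case using gt by simp
  next
    case (step k)
    let ?s = "recur_coef q k" and ?s' = "recur_coef q (Suc k)" and ?w = "q ^ m * haar_wt q k"
    have "q ^ k \<le> q ^ n" using step(1) q0 q1 by (intro power_decreasing) auto
    then have w: "2 * ?s + 2 * ?s' \<le> ?w" using assms by (intro haar_wt_lower_bound(1)) linarith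
    have s: "0 \<le> ?s" "0 < ?s'" using recur_coef_bounds recur_coef_Suc_pos by auto
    have "?s' * Y (Suc k) = - ((?w - ?s - ?s') * Y k + ?s * Y (k-1))"
      using legp_recurrence[of k "q ^ m"] unfolding Y_def by (simp add: algebra_simps)
    then have "?s' * \<bar>Y (Suc k)\<bar> = \<bar>(?w - ?s - ?s') * Y k + ?s * Y (k-1)\<bar>"
      using s by (metis abs_minus_cancel abs_mult abs_of_pos)
    also have "\<dots> \<ge> \<bar>(?w - ?s - ?s') * Y k\<bar> - \<bar>?s * Y (k-1)\<bar>" by linarith
    also have "\<bar>(?w - ?s - ?s') * Y k\<bar> = (?w - ?s - ?s') * \<bar>Y k\<bar>" using w s by (simp add: abs_mult)
    also have "\<bar>?s * Y (k-1)\<bar> = ?s * \<bar>Y (k-1)\<bar>" using s by (simp add: abs_mult)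
    finally have "?s' * \<bar>Y (Suc k)\<bar> \<ge> (?w - ?s - ?s') * \<bar>Y k\<bar> - ?s * \<bar>Y (k-1)\<bar>" .
    moreover have "?s * \<bar>Y (k-1)\<bar> \<le> ?s * \<bar>Y k\<bar>" using step.IH s by (intro mult_left_mono) auto
    moreover have "(2 * ?s + 2 * ?s') * \<bar>Y k\<bar> \<le> ?w * \<bar>Y k\<bar>" using w by (intro mult_right_mono) auto
    ultimately have "?s' * \<bar>Y k\<bar> \<le> ?s' * \<bar>Y (Suc k)\<bar>" by (simp add: algebra_simps)
    then have "\<bar>Y k\<bar> \<le> \<bar>Y (Suc k)\<bar>" using s by simp
    then show ?case using step.IH by simp
  qed
  have "\<bar>Y n\<bar> \<le> 0"
    using tendsto_rabs_zero[OF legp_degree_tendsto_0[of m]] grow unfolding Y_def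
    by (intro LIMSEQ_le_const[where X = "\<lambda>k. \<bar>legp q k (q ^ m)\<bar>"]) auto
  then show False using gt by simp
qed

text \<open>The recurrence is solved for the middle term; monotonicity bounds the next term by the
  middle one, so it can be absorbed on the left.\<close>

lemma abs_legp_decay:
  assumes "4 * q ^ n \<le> q ^ m"
  shows "\<bar>legp q n (q ^ m)\<bar> \<le> 4 * q ^ n / q ^ m * \<bar>legp q (n-1) (q ^ m)\<bar>"
proof -
  define Y where "Y k = legp q k (q ^ m)" for k
  let ?s = "recur_coef q n" and ?s' = "recur_coef q (Suc n)" and ?w = "q ^ m * haar_wt q n"
  have "q ^ Suc n \<le> q ^ n" using q0 q1 by (intro power_decreasing) auto
  then have "4 * q ^ Suc n \<le> q ^ m" using assms by linarith
  then have le: "\<bar>Y (Suc n)\<bar> \<le> \<bar>Y n\<bar>" unfolding Y_def using abs_legp_antimono[of "Suc n" m] by simp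
  have s: "0 \<le> ?s" "0 < ?s'" using recur_coef_bounds recur_coef_Suc_pos by auto
  have w: "2 * ?s + 2 * ?s' \<le> ?w" by (rule haar_wt_lower_bound(1)[OF assms])
  have "(?w - ?s - ?s') * Y n = - (?s' * Y (Suc n) + ?s * Y (n-1))"
    using legp_recurrence[of n "q ^ m"] unfolding Y_def by (simp add: algebra_simps)
  moreover have "?w - ?s - ?s' \<ge> 0" using w s by linarith
  ultimately have "(?w - ?s - ?s') * \<bar>Y n\<bar> = \<bar>?s' * Y (Suc n) + ?s * Y (n-1)\<bar>"
    by (metis abs_minus_cancel abs_mult abs_of_nonneg)
  also have "\<dots> \<le> \<bar>?s' * Y (Suc n)\<bar> + \<bar>?s * Y (n-1)\<bar>" by (rule abs_triangle_ineq)
  also have "\<dots> = ?s' * \<bar>Y (Suc n)\<bar> + ?s * \<bar>Y (n-1)\<bar>" using s by (simp add: abs_mult)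
  also have "\<dots> \<le> ?s' * \<bar>Y n\<bar> + ?s * \<bar>Y (n-1)\<bar>" using le s by simp
  finally have "(?w - ?s - 2 * ?s') * \<bar>Y n\<bar> \<le> ?s * \<bar>Y (n-1)\<bar>" by (simp add: algebra_simps)
  also have "\<dots> \<le> (4 * q ^ n / q ^ m * (?w - ?s - 2 * ?s')) * \<bar>Y (n-1)\<bar>"
    by (intro mult_right_mono haar_wt_lower_bound(2)[OF assms]) simp
  finally have *: "(?w - ?s - 2 * ?s') * \<bar>Y n\<bar> \<le> (?w - ?s - 2 * ?s') * (4 * q ^ n / q ^ m * \<bar>Y (n-1)\<bar>)"
    by (simp only: mult_ac)
  show ?thesis
  proof (cases "n = 0")
    \<comment> \<open>Impossible, since the hypothesis would give
      \<open>4 \<le> q ^ m\<close>.\<close>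
    case True
    have "q ^ m \<le> 1" using q0 q1 by (simp add: power_le_one)
    then show ?thesis using True assms by simp
  next
    case False
    then obtain j where "n = Suc j" by (cases n) auto
    then have "?s > 0" using recur_coef_Suc_pos by simp
    then have "?w - ?s - 2 * ?s' > 0" using w by linarith
    then show ?thesis using mult_left_le_imp_le[OF *] unfolding Y_def by simp
  qed
qed

section \<open>The explicit constant: head and tail estimates\<close>

lemma sum_haar_wt: "(1 - q) * (\<Sum>k\<le>N. haar_wt q k) = (1 - q ^ Suc N)^2 / q ^ N"
proof (induction N)
  case 0 then show ?case by (simp add: haar_wt_def power2_eq_square)
next
  case (Suc N)
  have "(1 - q * Q)^2 / Q + (1 - q) * ((1 - Q * Q * q * q * q) / (q * Q)) = (1 - q * (q * Q))^2 / (q * Q)"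
    if "Q > 0" for Q
    using that q0 by (simp add: field_simps power2_eq_square)
  from this[of "q ^ N"] have "(1 - q ^ Suc N)^2 / q ^ N + (1 - q) * haar_wt q (Suc N) = (1 - q ^ Suc (Suc N))^2 / q ^ Suc N"
    using q0 by (simp add: haar_wt_eq mult_ac)
  then show ?case using Suc by (simp add: distrib_left)
qed

text \<open>The property for which \<open>Kq\<close> is chosen: from \<open>n = m + Kq q + 1\<close>
  on, \<open>abs_legp_decay\<close> applies. Truncation by \<open>nat\<close> can only increase the
  value.\<close>

lemma Kq_bound: "4 * q ^ Suc (Kq q) \<le> 1"
proof -
  define K where "K = Kq q"
  have l: "ln (1 / q) > 0" using q0 q1 by (simp add: ln_div)
  have "ln 4 / ln (1 / q) - 1 \<le> real K" unfolding K_def Kq_def by linarith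
  then have "ln 4 \<le> (real K + 1) * ln (1 / q)" using l by (simp add: divide_le_eq algebra_simps)
  also have "\<dots> = ln ((1 / q) ^ Suc K)" using q0 by (subst ln_realpow) (auto simp: algebra_simps)
  finally have "4 \<le> (1 / q) ^ Suc K" using q0 by (subst (asm) ln_le_cancel_iff) auto
  then show ?thesis unfolding K_def[symmetric] using q0 by (simp add: power_divide le_divide_eq)
qed

lemma Cq_term_0: "Cq_term q 0 = 4 * q ^ Kq q"
  unfolding Cq_term_def using q0 by (simp add: powr_realpow)

text \<open>The exponent is the sum of \<open>Kq q + i\<close> over \<open>i \<le> k\<close>, so
  each term is a product of factors \<open>4 * q ^ (Kq q + i)\<close>.\<close>

lemma Cq_term_Suc: "Cq_term q (Suc k) = Cq_term q k * (4 * q ^ (Kq q + Suc k))"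
proof -
  have "(2 * real (Kq q) + real (Suc k+1) - 1) * real (Suc k+1) / 2
     = (2 * real (Kq q) + real (k+1) - 1) * real (k+1) / 2 + real (Kq q + Suc k)"
    by (simp add: field_simps)
  then show ?thesis unfolding Cq_term_def using q0 by (simp only: powr_add powr_realpow) (simp add: mult_ac)
qed

lemma Cq_term_nonneg: "Cq_term q k \<ge> 0"
  unfolding Cq_term_def by simp

lemma summable_Cq_term: "summable (Cq_term q)"
\<comment> \<open>From \<open>k = 1\<close> on, \<open>Kq_bound\<close> leaves a spare factor
  \<open>q\<close> in the ratio.\<close>
proof (rule summable_ratio_test[where c = q and N = 1])
  fix k :: nat assume "1 \<le> k"
  then have "q ^ (Kq q + Suc k) \<le> q ^ Suc (Suc (Kq q))" using q0 q1 by (intro power_decreasing) auto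
  also have "4 * \<dots> \<le> q" using mult_right_mono[OF Kq_bound, of q] q0 by (simp add: mult_ac)
  finally have "Cq_term q k * (4 * q ^ (Kq q + Suc k)) \<le> Cq_term q k * q"
    by (intro mult_left_mono) (auto simp: Cq_term_nonneg)
  then show "norm (Cq_term q (Suc k)) \<le> q * norm (Cq_term q k)"
    unfolding Cq_term_Suc using Cq_term_nonneg[of k] q0 by (simp add: abs_mult mult_ac)
qed (use q1 in simp)

text \<open>Starting from the bound 1 at index \<open>m + Kq q\<close>, every step gains
  \<open>4 * q ^ (Kq q + i)\<close> with \<open>i \<ge> 1\<close>. That is one \<open>q\<close> per
  step more than in \<open>Cq_term\<close>; the surplus \<open>q ^ Suc k\<close> offsets the growth
  of the Haar weights.\<close>

lemma abs_legp_tail: "\<bar>legp q (m + Kq q + Suc k) (q ^ m)\<bar> \<le> Cq_term q k * q ^ Suc k"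
proof -
  have decay: "\<bar>legp q (m + Kq q + Suc k) (q ^ m)\<bar> \<le> 4 * q ^ (Kq q + Suc k) * \<bar>legp q (m + Kq q + k) (q ^ m)\<bar>" for k
  proof -
    have "q ^ (Kq q + Suc k) \<le> q ^ Suc (Kq q)" using q0 q1 by (intro power_decreasing) auto
    then have "4 * q ^ (Kq q + Suc k) \<le> 1" using Kq_bound by linarith
    then have "q ^ m * (4 * q ^ (Kq q + Suc k)) \<le> q ^ m * 1" using q0 by (intro mult_left_mono) auto
    then have "4 * q ^ (m + Kq q + Suc k) \<le> q ^ m" by (simp add: power_add mult_ac)
    from abs_legp_decay[OF this] show ?thesis using q0 by (simp add: power_add)
  qed
  show ?thesis
  proof (induction k)
    case 0
    have "4 * q ^ (Kq q + Suc 0) * \<bar>legp q (m + Kq q + 0) (q ^ m)\<bar> \<le> 4 * q ^ (Kq q + Suc 0) * 1"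
      using q0 by (intro mult_left_mono abs_legp_le_1) auto
    then show ?case using decay[of 0] by (simp add: Cq_term_0 mult_ac)
  next
    case (Suc k)
    have "4 * q ^ (Kq q + Suc (Suc k)) * \<bar>legp q (m + Kq q + Suc k) (q ^ m)\<bar>
       \<le> 4 * q ^ (Kq q + Suc (Suc k)) * (Cq_term q k * q ^ Suc k)"
      using q0 Suc by (intro mult_left_mono) auto
    also have "\<dots> = Cq_term q (Suc k) * q ^ Suc (Suc k)" unfolding Cq_term_Suc by (simp add: mult_ac)
    finally show ?case using decay[of "Suc k"] by linarith
  qed
qed

lemma Cq_eq: "Cq q = (1 / q ^ Kq q) * (1 / (1 - q) + 1 / (1 - q ^ (2 * Kq q + 1)) * suminf (Cq_term q))"
  by (simp only: Cq_def Cq_term_def[abs_def])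

lemma Cq_ge: "(1 / q ^ Kq q) * (1 / (1 - q) + suminf (Cq_term q)) \<le> Cq q"
proof -
  have d: "0 < 1 - q ^ (2 * Kq q + 1)" "1 - q ^ (2 * Kq q + 1) \<le> 1"
    using pow_less_1[of "2 * Kq q"] q0 by auto
  then have "1 \<le> 1 / (1 - q ^ (2 * Kq q + 1))" by simp
  then have "1 * suminf (Cq_term q) \<le> 1 / (1 - q ^ (2 * Kq q + 1)) * suminf (Cq_term q)"
    by (intro mult_right_mono suminf_nonneg summable_Cq_term Cq_term_nonneg)
  then show ?thesis unfolding Cq_eq using q0 by (intro mult_left_mono) auto
qed

lemma sum_abs_less: "(\<Sum>k. \<bar>legp q k (q ^ m)\<bar> * haar_wt q k) < Cq q / q ^ m"
proof -
  define N where "N = m + Kq q"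
  define f where "f k = \<bar>legp q k (q ^ m)\<bar> * haar_wt q k" for k
  have sf: "summable f"
    unfolding f_def using rapid_summable_abs[OF rapid_haar_wt[OF rapid_legp]] haar_wt_pos by (simp add: abs_mult abs_of_pos)
  have "(\<Sum>k<Suc N. f k) \<le> (\<Sum>k\<le>N. haar_wt q k)"
    unfolding lessThan_Suc_atMost f_def
    using mult_right_mono[OF abs_legp_le_1 less_imp_le[OF haar_wt_pos]] by (intro sum_mono) simp
  \<comment> \<open>The strictness of the upper norm inequality comes from the head.\<close>
  also have "\<dots> < 1 / q ^ N / (1 - q)"
  proof -
    have "(1 - q ^ Suc N)^2 < 1" using pow_less_1[of N] q0 by (simp add: power_less_one_iff abs_square_less_1)
    then have "(1 - q) * (\<Sum>k\<le>N. haar_wt q k) < 1 / q ^ N" unfolding sum_haar_wt using q0 by (simp add: divide_strict_right_mono)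
    then show ?thesis using q1 by (subst pos_less_divide_eq) (simp_all add: mult.commute)
  qed
  finally have head: "(\<Sum>k<Suc N. f k) < 1 / q ^ N / (1 - q)" .
  have tail: "(\<Sum>k. f (k + Suc N)) \<le> (\<Sum>k. 1 / q ^ N * Cq_term q k)"
  proof (rule suminf_le)
    fix k
    have "f (N + Suc k) \<le> (Cq_term q k * q ^ Suc k) * (1 / q ^ (N + Suc k))"
      unfolding f_def N_def using haar_wt_pos[of "m + Kq q + Suc k"] q0
      by (intro mult_mono abs_legp_tail haar_wt_le mult_nonneg_nonneg Cq_term_nonneg) auto
    also have "\<dots> = 1 / q ^ N * Cq_term q k" using q0 by (simp add: power_add)
    finally show "f (k + Suc N) \<le> 1 / q ^ N * Cq_term q k" by (simp add: add.commute)
  qed (use sf summable_Cq_term in \<open>auto intro: summable_mult simp: summable_iff_shift simp del: add_Suc_right\<close>)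
  have "suminf f = (\<Sum>k. f (k + Suc N)) + (\<Sum>k<Suc N. f k)"
    by (rule suminf_split_initial_segment[OF sf])
  also have "\<dots> < 1 / q ^ N * suminf (Cq_term q) + 1 / q ^ N / (1 - q)"
    using head tail unfolding suminf_mult[OF summable_Cq_term] by linarith
  also have "\<dots> = 1 / q ^ m * ((1 / q ^ Kq q) * (1 / (1 - q) + suminf (Cq_term q)))"
    unfolding N_def by (simp add: power_add distrib_left mult_ac)
  also have "\<dots> \<le> 1 / q ^ m * Cq q" using q0 by (intro mult_left_mono Cq_ge) auto
  finally show ?thesis unfolding f_def by simp
qed

section \<open>The norms\<close>

lemma haar_eq: "haar q k = haar_wt q k / (1 - q)"
  by (simp add: haar_def haar_wt_def)

lemma alpha_eq: "alpha q (1 - q ^ m) k = legp q k (q ^ m)"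
  by (simp add: alpha_def legp_def)

lemma summable_abs_haar: "summable (\<lambda>k. \<bar>alpha q (1 - q ^ m) k\<bar> * haar q k)"
  using summable_divide[OF rapid_summable_abs[OF rapid_haar_wt[OF rapid_legp[of m]]], of "1 - q"] haar_wt_pos
  by (simp add: alpha_eq haar_eq abs_mult abs_of_pos)

lemma sums_square_haar: "(\<lambda>k. \<bar>alpha q (1 - q ^ m) k\<bar>^2 * haar q k) sums (1 / q ^ m / (1 - q))"
  using sums_divide[OF legp_sum_squares[of m], of "1 - q"] by (simp add: alpha_eq haar_eq)

lemma norm2sq_eq: "norm2sq q (alpha q (1 - q ^ m)) = 1 / q ^ m / (1 - q)"
  unfolding norm2sq_def using sums_square_haar by (rule sums_unique[symmetric])

lemma norm1_eq: "norm1 q (alpha q (1 - q ^ m)) = (\<Sum>k. \<bar>legp q k (q ^ m)\<bar> * haar_wt q k) / (1 - q)"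
  unfolding norm1_def
  using suminf_divide[OF rapid_summable_abs[OF rapid_haar_wt[OF rapid_legp[of m]]], of "1 - q"] haar_wt_pos
  by (simp add: alpha_eq haar_eq abs_mult abs_of_pos)

lemma norm2sq_pos: "0 < norm2sq q (alpha q (1 - q ^ m))"
  unfolding norm2sq_eq using q0 q1 by simp

lemma norm2sq_less_norm1: "norm2sq q (alpha q (1 - q ^ m)) < norm1 q (alpha q (1 - q ^ m))"
  using sum_squares_less_sum_abs[of m] sums_unique[OF legp_sum_squares[of m]] q1
  unfolding norm2sq_eq norm1_eq by (simp add: divide_strict_right_mono)

lemma norm1_less: "norm1 q (alpha q (1 - q ^ m)) < Cq q * norm2sq q (alpha q (1 - q ^ m))"
  using divide_strict_right_mono[OF sum_abs_less[of m], of "1 - q"] q1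
  unfolding norm2sq_eq norm1_eq by simp

lemma Cq_pos: "0 < Cq q"
proof -
  have "0 < norm1 q (alpha q (1 - q ^ 0))" using norm2sq_pos[of 0] norm2sq_less_norm1[of 0] by linarith
  then have "0 < Cq q * norm2sq q (alpha q (1 - q ^ 0))" using norm1_less[of 0] by linarith
  then show ?thesis using norm2sq_pos[of 0] by (simp add: zero_less_mult_iff)
qed

end

theorem theorem2p1:
  fixes q :: real
  assumes "0 < q" and "q < 1"
  shows "(\<exists>C>0. \<forall>n::nat.
            summable (\<lambda>k. \<bar>alpha q (1 - q ^ n) k\<bar> * haar q k) \<and>
            summable (\<lambda>k. \<bar>alpha q (1 - q ^ n) k\<bar>^2 * haar q k) \<and>
            0 < norm2sq q (alpha q (1 - q ^ n)) \<and>
            norm2sq q (alpha q (1 - q ^ n)) < norm1 q (alpha q (1 - q ^ n)) \<and>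
            norm1 q (alpha q (1 - q ^ n)) < C * norm2sq q (alpha q (1 - q ^ n)))
       \<and> 0 < Cq q
       \<and> (\<forall>n::nat.
            norm1 q (alpha q (1 - q ^ n)) < Cq q * norm2sq q (alpha q (1 - q ^ n)))"
  by (intro conjI exI[of _ "Cq q"] allI summable_abs_haar[OF assms] sums_summable[OF sums_square_haar[OF assms]]
    norm2sq_pos[OF assms] norm2sq_less_norm1[OF assms] norm1_less[OF assms] Cq_pos[OF assms])

end
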